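(* Let $\Psi:\mathcal{M}\times A\to\mathbb{R}$ be a Kempf-Ness function for $(\mathcal{M},A,\{e\})$ with gradient map $\mathfrak{F}:\mathcal{M}\to\mathfrak{a}$, and let $x\in\mathcal{M}$. If $\overline{A\cdot x}$ is compact, then $$\overline{\mathfrak{F}(A\cdot x)}=\mathfrak{F}(\overline{A\cdot x})=\operatorname{conv}\big(\mathfrak{F}(\overline{A\cdot x}\cap\mathcal{M}^A)\big),$$ where $\mathcal{M}^A$ is the set of $A$-fixed points in $\mathcal{M}$ and $\operatorname{conv}$ denotes the convex hull.
   Context: $G$ is a non-compact real reductive Lie group with Cartan decomposition $G=K\exp(\mathfrak{p})$, where $K$ is a maximal compact subgroup and $(k,\xi)\mapsto k\exp(\xi)$ is a diffeomorphism $K\times\mathfrak{p}\to G$. $\mathcal{M}$ is a Hausdorff topological space on which $G$ acts continuously. $\mathfrak{a}\subset\mathfrak{p}$ is an abelian subalgebra and $A=\exp(\mathfrak{a})\subset G$, so $\exp:\mathfrak{a}\to A$ is an isomorphism of Lie groups. A $K$-invariant scalar product $\langle\,,\,\rangle$ on $\mathfrak{p}$ is fixed; it restricts to $\mathfrak{a}$, and $\mathfrak{a}^*\cong\mathfrak{a}$ via $\langle\,,\,\rangle$. For $x\in\mathcal{M}$, $A_x$ is its stabilizer in $A$. A Kempf-Ness function for $(\mathcal{M},A,\{e\})$ is a function $\Psi:\mathcal{M}\times A\to\mathbb{R}$ such that: (P1) for every $x\in\mathcal{M}$, $\Psi(x,\cdot)$ is smooth on $A$; (P2) $\Psi(x,\cdot)$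 is left-invariant under the maximal compact subgroup (here $\{e\}$, so this condition is void); (P3) for every $x\in\mathcal{M}$, $\xi\in\mathfrak{a}$, $t\in\mathbb{R}$, $\frac{d^2}{dt^2}\Psi(x,\exp(t\xi))\ge0$, and $\frac{d^2}{dt^2}\big|_{t=0}\Psi(x,\exp(t\xi))=0$ if and only if $\exp(\mathbb{R}\xi)\subset A_x$; (P4) (cocycle condition) $\Psi(x,g)+\Psi(gx,h)=\Psi(x,hg)$ for all $x\in\mathcal{M}$, $g,h\in A$; (P5) the map $\mathfrak{F}:\mathcal{M}\to\mathfrak{a}^*\cong\mathfrak{a}$ defined by $\langle\mathfrak{F}(x),\xi\rangle=\frac{d}{dt}\big|_{t=0}\Psi(x,\exp(t\xi))$ for $\xi\in\mathfrak{a}$ is continuous. The map $\mathfrak{F}$ is called the gradient map. *)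

theory Defs
  imports "HOL-Analysis.Analysis" "HOL-Algebra.Group_Action"
begin

section \<open>Smooth maps and smooth manifolds\<close>

text \<open>The sets \<open>S\<close> are open in all uses; \<open>C\<^sup>k\<close> is expressed by iterated directional derivatives.\<close>

primrec Ck_on :: "nat \<Rightarrow> 'a::euclidean_space set \<Rightarrow> ('a \<Rightarrow> 'b::real_normed_vector) \<Rightarrow> bool" where
  "Ck_on 0 S f \<longleftrightarrow> continuous_on S f"
| "Ck_on (Suc k) S f \<longleftrightarrow>
     (\<forall>x\<in>S. f differentiable (at x)) \<and>
     (\<forall>v. Ck_on k S (\<lambda>x. frechet_derivative f (at x) v))"

definition smooth_on :: "'a::euclidean_space set \<Rightarrow> ('a \<Rightarrow> 'b::real_normed_vector) \<Rightarrow> bool" where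
  "smooth_on S f \<longleftrightarrow> (\<forall>k. Ck_on k S f)"

type_synonym ('a, 'e) chart = "'a set \<times> ('a \<Rightarrow> 'e)"

definition smooth_atlas :: "('a::topological_space, 'e::euclidean_space) chart set \<Rightarrow> bool" where
  "smooth_atlas \<A> \<longleftrightarrow>
     (\<Union>(U, \<phi>)\<in>\<A>. U) = UNIV \<and>
     (\<forall>(U, \<phi>)\<in>\<A>. open U \<and> open (\<phi> ` U) \<and> homeomorphism U (\<phi> ` U) \<phi> (inv_into U \<phi>)) \<and>
     (\<forall>(U, \<phi>)\<in>\<A>. \<forall>(V, \<psi>)\<in>\<A>. smooth_on (\<phi> ` (U \<inter> V)) (\<psi> \<circ> inv_into U \<phi>))"

definition smooth_map ::
  "('a::topological_space, 'e::euclidean_space) chart set \<Rightarrow>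
   ('b::topological_space, 'f::euclidean_space) chart set \<Rightarrow> ('a \<Rightarrow> 'b) \<Rightarrow> bool" where
  "smooth_map \<A> \<B> f \<longleftrightarrow>
     continuous_on UNIV f \<and>
     (\<forall>(U, \<phi>)\<in>\<A>. \<forall>(V, \<psi>)\<in>\<B>. smooth_on (\<phi> ` (U \<inter> f -` V)) (\<psi> \<circ> f \<circ> inv_into U \<phi>))"

definition euclidean_atlas :: "('e::euclidean_space, 'e) chart set" where
  "euclidean_atlas = {(UNIV, id)}"

definition product_atlas ::
  "('a, 'e) chart set \<Rightarrow> ('b, 'f) chart set \<Rightarrow> ('a \<times> 'b, 'e \<times> 'f) chart set" where
  "product_atlas \<A> \<B> = {(U \<times> V, map_prod \<phi> \<psi>) | U \<phi> V \<psi>. (U, \<phi>) \<in> \<A> \<and> (V, \<psi>) \<in> \<B>}"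

section \<open>Lie groups\<close>

text \<open>
  The type \<open>'g\<close> is the underlying manifold. A chart \<open>\<kappa>\<close> around the identity is part of the data;
  its differential identifies the tangent space at the identity, i.e. the Lie algebra of the
  group, with the model space \<open>'e\<close>.
\<close>

locale lie_group =
  fixes G :: "('g::{t2_space, second_countable_topology}) monoid" (structure)
    and \<A> :: "('g, 'e::euclidean_space) chart set"
    and \<kappa> :: "'g \<Rightarrow> 'e"
  assumes group_G: "group G"
    and carrier_G: "carrier G = UNIV"
    and atlas: "smooth_atlas \<A>"
    and smooth_mult: "smooth_map (product_atlas \<A> \<A>) \<A> (\<lambda>(g, h). g \<otimes> h)"
    and smooth_inv: "smooth_map \<A> \<A> (\<lambda>g. inv g)"
    and chart_one: "\<exists>U. (U, \<kappa>) \<in> \<A> \<and> \<one> \<in> U"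

text \<open>
  \<open>t \<mapsto> ex (t \<xi>)\<close> is the one-parameter subgroup with initial velocity \<open>\<xi>\<close>. One-parameter subgroups
  are determined by their initial velocity, so this determines \<open>ex\<close>.
\<close>

definition exponential_map ::
  "('g::topological_space) monoid \<Rightarrow> ('g, 'e::euclidean_space) chart set \<Rightarrow> ('g \<Rightarrow> 'e) \<Rightarrow>
   ('e \<Rightarrow> 'g) \<Rightarrow> bool" where
  "exponential_map G \<A> \<kappa> ex \<longleftrightarrow>
     (\<forall>\<xi>. smooth_map euclidean_atlas \<A> (\<lambda>t::real. ex (t *\<^sub>R \<xi>)) \<and>
          (\<forall>s t. ex ((s + t) *\<^sub>R \<xi>) = ex (s *\<^sub>R \<xi>) \<otimes>\<^bsub>G\<^esub> ex (t *\<^sub>R \<xi>)) \<and>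
          ((\<lambda>t. \<kappa> (ex (t *\<^sub>R \<xi>))) has_vector_derivative \<xi>) (at 0))"

definition Ad ::
  "'g monoid \<Rightarrow> ('g \<Rightarrow> 'e::euclidean_space) \<Rightarrow> ('e \<Rightarrow> 'g) \<Rightarrow> 'g \<Rightarrow> 'e \<Rightarrow> 'e" where
  "Ad G \<kappa> ex g \<eta> =
     vector_derivative (\<lambda>t. \<kappa> (g \<otimes>\<^bsub>G\<^esub> ex (t *\<^sub>R \<eta>) \<otimes>\<^bsub>G\<^esub> inv\<^bsub>G\<^esub> g)) (at 0)"

text \<open>The Lie bracket is \<open>[\<xi>, \<eta>] = ad \<xi> \<eta>\<close>, where \<open>ad\<close> is the differential of \<open>Ad\<close>.\<close>

definition lie_bracket ::
  "'g monoid \<Rightarrow> ('g \<Rightarrow> 'e::euclidean_space) \<Rightarrow> ('e \<Rightarrow> 'g) \<Rightarrow> 'e \<Rightarrow> 'e \<Rightarrow> 'e" where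
  "lie_bracket G \<kappa> ex \<xi> \<eta> = vector_derivative (\<lambda>s. Ad G \<kappa> ex (ex (s *\<^sub>R \<xi>)) \<eta>) (at 0)"

definition lie_algebra_of :: "('e::euclidean_space \<Rightarrow> 'g) \<Rightarrow> 'g set \<Rightarrow> 'e set" where
  "lie_algebra_of ex H = {\<xi>. \<forall>t. ex (t *\<^sub>R \<xi>) \<in> H}"

definition lie_ideal :: "('e::euclidean_space \<Rightarrow> 'e \<Rightarrow> 'e) \<Rightarrow> 'e set \<Rightarrow> bool" where
  "lie_ideal br I \<longleftrightarrow> subspace I \<and> (\<forall>\<xi>. \<forall>\<eta>\<in>I. br \<xi> \<eta> \<in> I)"

definition reductive_lie_algebra :: "('e::euclidean_space \<Rightarrow> 'e \<Rightarrow> 'e) \<Rightarrow> bool" where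
  "reductive_lie_algebra br \<longleftrightarrow>
     (\<forall>I. lie_ideal br I \<longrightarrow>
        (\<exists>J. lie_ideal br J \<and> I \<inter> J = {0} \<and> {\<xi> + \<eta> | \<xi> \<eta>. \<xi> \<in> I \<and> \<eta> \<in> J} = UNIV))"

definition maximal_compact_subgroup :: "'g::topological_space set \<Rightarrow> 'g monoid \<Rightarrow> bool" where
  "maximal_compact_subgroup K G \<longleftrightarrow>
     subgroup K G \<and> compact K \<and> (\<forall>H. subgroup H G \<and> compact H \<and> K \<subseteq> H \<longrightarrow> H = K)"

section \<open>Real reductive groups with a Cartan decomposition\<close>

text \<open>
  \<open>G\<close> is a non-compact real reductive Lie group, \<open>K\<close> a maximal compact subgroup with Lie algebra
  \<open>\<kk>\<close>, and \<open>\<gg> = \<kk> \<oplus> \<pp>\<close> a Cartan decomposition; the form \<open>B\<close> is the invariant form of such a group.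
  In the last assumption \<open>K \<times> \<pp>\<close> is an embedded submanifold of \<open>G \<times> \<gg>\<close>. Hence \<open>(k, \<xi>) \<mapsto> k exp \<xi>\<close> is a
  diffeomorphism from \<open>K \<times> \<pp>\<close> onto \<open>G\<close> iff it is smooth and has an inverse \<open>g \<mapsto> (\<sigma> g, \<pi> g)\<close> whose
  components are smooth as maps into \<open>G\<close> and \<open>\<gg>\<close>.
\<close>

locale real_reductive_group = lie_group G \<A> \<kappa>
  for G :: "('g::{t2_space, second_countable_topology}) monoid" (structure)
    and \<A> :: "('g, 'e::euclidean_space) chart set"
    and \<kappa> :: "'g \<Rightarrow> 'e" +
  fixes ex :: "'e \<Rightarrow> 'g"
    and K :: "'g set"
    and \<pp> :: "'e set"
  assumes exponential: "exponential_map G \<A> \<kappa> ex"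
    and noncompact: "\<not> compact (carrier G)"
    and reductive: "reductive_lie_algebra (lie_bracket G \<kappa> ex)"
    and maximal_compact: "maximal_compact_subgroup K G"
    and subspace_p: "subspace \<pp>"
    and direct_inter: "lie_algebra_of ex K \<inter> \<pp> = {0}"
    and direct_sum: "{\<xi> + \<eta> | \<xi> \<eta>. \<xi> \<in> lie_algebra_of ex K \<and> \<eta> \<in> \<pp>} = UNIV"
    and bracket_kk: "\<lbrakk>\<xi> \<in> lie_algebra_of ex K; \<eta> \<in> lie_algebra_of ex K\<rbrakk>
          \<Longrightarrow> lie_bracket G \<kappa> ex \<xi> \<eta> \<in> lie_algebra_of ex K"
    and bracket_kp: "\<lbrakk>\<xi> \<in> lie_algebra_of ex K; \<eta> \<in> \<pp>\<rbrakk> \<Longrightarrow> lie_bracket G \<kappa> ex \<xi> \<eta> \<in> \<pp>"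
    and bracket_pp: "\<lbrakk>\<xi> \<in> \<pp>; \<eta> \<in> \<pp>\<rbrakk> \<Longrightarrow> lie_bracket G \<kappa> ex \<xi> \<eta> \<in> lie_algebra_of ex K"
    and invariant_form:
      "\<exists>B :: 'e \<Rightarrow> 'e \<Rightarrow> real. bilinear B \<and> (\<forall>\<xi> \<eta>. B \<xi> \<eta> = B \<eta> \<xi>) \<and>
         (\<forall>g \<xi> \<eta>. B (Ad G \<kappa> ex g \<xi>) (Ad G \<kappa> ex g \<eta>) = B \<xi> \<eta>) \<and>
         (\<forall>\<xi>\<in>lie_algebra_of ex K. \<forall>\<eta>\<in>\<pp>. B \<xi> \<eta> = 0) \<and>
         (\<forall>\<xi>\<in>lie_algebra_of ex K. \<xi> \<noteq> 0 \<longrightarrow> B \<xi> \<xi> < 0) \<and>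
         (\<forall>\<xi>\<in>\<pp>. \<xi> \<noteq> 0 \<longrightarrow> B \<xi> \<xi> > 0)"
    and cartan_diffeomorphism:
      "smooth_map (product_atlas \<A> euclidean_atlas) \<A> (\<lambda>(g, \<xi>). g \<otimes> ex \<xi>) \<and>
       (\<exists>\<sigma> \<pi>. smooth_map \<A> \<A> \<sigma> \<and> smooth_map \<A> euclidean_atlas \<pi> \<and>
         (\<forall>g. \<sigma> g \<in> K \<and> \<pi> g \<in> \<pp> \<and> \<sigma> g \<otimes> ex (\<pi> g) = g) \<and>
         (\<forall>k\<in>K. \<forall>\<xi>\<in>\<pp>. \<sigma> (k \<otimes> ex \<xi>) = k \<and> \<pi> (k \<otimes> ex \<xi>) = \<xi>))"

definition abelian_subalgebra ::
  "('e::euclidean_space \<Rightarrow> 'e \<Rightarrow> 'e) \<Rightarrow> 'e set \<Rightarrow> bool" where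
  "abelian_subalgebra br \<aa> \<longleftrightarrow> subspace \<aa> \<and> (\<forall>\<xi>\<in>\<aa>. \<forall>\<eta>\<in>\<aa>. br \<xi> \<eta> = 0)"

definition scalar_product_on :: "'e::real_vector set \<Rightarrow> ('e \<Rightarrow> 'e \<Rightarrow> real) \<Rightarrow> bool" where
  "scalar_product_on V ip \<longleftrightarrow>
     (\<forall>\<xi>\<in>V. \<forall>\<eta>\<in>V. \<forall>\<zeta>\<in>V. ip (\<xi> + \<eta>) \<zeta> = ip \<xi> \<zeta> + ip \<eta> \<zeta>) \<and>
     (\<forall>c. \<forall>\<xi>\<in>V. \<forall>\<eta>\<in>V. ip (c *\<^sub>R \<xi>) \<eta> = c * ip \<xi> \<eta>) \<and>
     (\<forall>\<xi>\<in>V. \<forall>\<eta>\<in>V. ip \<xi> \<eta> = ip \<eta> \<xi>) \<and>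
     (\<forall>\<xi>\<in>V. \<xi> \<noteq> 0 \<longrightarrow> ip \<xi> \<xi> > 0)"

definition Ad_invariant_on ::
  "'g monoid \<Rightarrow> ('g \<Rightarrow> 'e::euclidean_space) \<Rightarrow> ('e \<Rightarrow> 'g) \<Rightarrow> 'g set \<Rightarrow> 'e set \<Rightarrow>
   ('e \<Rightarrow> 'e \<Rightarrow> real) \<Rightarrow> bool" where
  "Ad_invariant_on G \<kappa> ex K V ip \<longleftrightarrow>
     (\<forall>k\<in>K. \<forall>\<xi>\<in>V. \<forall>\<eta>\<in>V. ip (Ad G \<kappa> ex k \<xi>) (Ad G \<kappa> ex k \<eta>) = ip \<xi> \<eta>)"

definition continuous_action ::
  "'g::topological_space monoid \<Rightarrow> ('g \<Rightarrow> 'm::topological_space \<Rightarrow> 'm) \<Rightarrow> bool" where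
  "continuous_action G act \<longleftrightarrow>
     group_action G UNIV act \<and> continuous_on (carrier G \<times> UNIV) (\<lambda>(g, y). act g y)"

section \<open>Kempf-Ness functions\<close>

text \<open>
  Below \<open>A = exp \<aa>\<close>, and \<open>G\<lparr>carrier := A\<rparr>\<close> is \<open>A\<close> as a group. Only the values of \<open>\<Psi> x\<close> on \<open>A\<close> matter.
\<close>

definition gradient_map ::
  "('e::euclidean_space \<Rightarrow> 'g) \<Rightarrow> 'e set \<Rightarrow> ('e \<Rightarrow> 'e \<Rightarrow> real) \<Rightarrow> ('m \<Rightarrow> 'g \<Rightarrow> real) \<Rightarrow> 'm \<Rightarrow> 'e" where
  "gradient_map ex \<aa> ip \<Psi> x =
     (THE \<zeta>. \<zeta> \<in> \<aa> \<and> (\<forall>\<xi>\<in>\<aa>. ip \<zeta> \<xi> = deriv (\<lambda>t. \<Psi> x (ex (t *\<^sub>R \<xi>))) 0))"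

text \<open>
  The smooth structure of \<open>A\<close> is the one for which \<open>exp : \<aa> \<rightarrow> A\<close> is a diffeomorphism. A function on
  the subspace \<open>\<aa>\<close> is smooth iff its composition with each linear map into \<open>\<aa>\<close> is smooth (a linear
  projection onto \<open>\<aa>\<close> suffices). Left invariance under the maximal compact subgroup \<open>{e}\<close> of \<open>A\<close> is
  void and does not appear.
\<close>

definition kempf_ness ::
  "'g monoid \<Rightarrow> ('g \<Rightarrow> 'm::topological_space \<Rightarrow> 'm) \<Rightarrow> ('e::euclidean_space \<Rightarrow> 'g) \<Rightarrow> 'e set \<Rightarrow>
   ('e \<Rightarrow> 'e \<Rightarrow> real) \<Rightarrow> ('m \<Rightarrow> 'g \<Rightarrow> real) \<Rightarrow> bool" where
  "kempf_ness G act ex \<aa> ip \<Psi> \<longleftrightarrow>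
     (\<forall>x. \<forall>L::'e \<Rightarrow> 'e. linear L \<and> range L \<subseteq> \<aa> \<longrightarrow> smooth_on UNIV (\<lambda>\<zeta>. \<Psi> x (ex (L \<zeta>)))) \<and>
     (\<forall>x. \<forall>\<xi>\<in>\<aa>.
        (\<forall>t. (deriv ^^ 2) (\<lambda>s. \<Psi> x (ex (s *\<^sub>R \<xi>))) t \<ge> 0) \<and>
        ((deriv ^^ 2) (\<lambda>s. \<Psi> x (ex (s *\<^sub>R \<xi>))) 0 = 0 \<longleftrightarrow>
           range (\<lambda>t. ex (t *\<^sub>R \<xi>)) \<subseteq> stabilizer (G\<lparr>carrier := ex ` \<aa>\<rparr>) act x)) \<and>
     (\<forall>x. \<forall>g\<in>ex ` \<aa>. \<forall>h\<in>ex ` \<aa>. \<Psi> x g + \<Psi> (act g x) h = \<Psi> x (h \<otimes>\<^bsub>G\<^esub> g)) \<and>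
     continuous_on UNIV (gradient_map ex \<aa> ip \<Psi>)"

definition fixed_points :: "'g set \<Rightarrow> ('g \<Rightarrow> 'm \<Rightarrow> 'm) \<Rightarrow> 'm set" where
  "fixed_points A act = (\<Inter>a\<in>A. invariants UNIV act a)"

end

theory Submission
  imports Defs
begin

text \<open>
  Vanishing brackets make \<open>exp : \<aa> \<rightarrow> A\<close> a homomorphism, so \<open>f \<zeta> = \<Psi> x (exp \<zeta>)\<close> is a convex function on \<open>\<aa>\<close>
  whose gradient at \<open>\<zeta>\<close> is \<open>\<FF> (exp \<zeta> x)\<close>.

  The closure of \<open>\<FF> (A x)\<close> is convex: if \<open>p\<close> is a convex combination of gradients, then
  \<open>f - \<langle>p, \<cdot>\<rangle>\<close> is bounded below, and the minimiser of this function plus \<open>\<epsilon>/2 |\<zeta>|\<^sup>2\<close> has gradient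
  tending to \<open>p\<close> as \<open>\<epsilon> \<rightarrow> 0\<close>.

  Conversely, every linear functional \<open>\<langle>\<cdot>, \<xi>\<rangle>\<close> attains its maximum over \<open>\<FF> (closure (A x))\<close> at a fixed
  point. By convexity along \<open>exp (t \<xi>)\<close> the maximisers are fixed by \<open>exp (\<real> \<xi>)\<close>; hence \<open>\<langle>\<FF>, \<xi>\<rangle>\<close> is constant
  on their \<open>A\<close>-orbits, so they form a compact \<open>A\<close>-invariant set, and one repeats the argument on it with
  the elements of a basis of \<open>\<aa>\<close>. The convex hull of the image of the fixed points is compact, so
  separation gives the remaining inclusion.
\<close>

section \<open>Calculus of \<open>C\<^sup>k\<close> maps\<close>

lemma Ck_on_subset: "Ck_on k S f \<Longrightarrow> T \<subseteq> S \<Longrightarrow> Ck_on k T f"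
  by (induction k arbitrary: f) (auto intro: continuous_on_subset)

text \<open>\<open>frechet_derivative f (at x)\<close> does not depend on the set, so a local
  hypothesis passes to the derivatives and the induction closes. Smoothness can thus be checked
  chart by chart.\<close>

lemma Ck_on_local:
  assumes "\<And>x. x \<in> S \<Longrightarrow> \<exists>T. open T \<and> x \<in> T \<and> Ck_on k T f"
  shows "Ck_on k S f"
  using assms
proof (induction k arbitrary: f)
  case 0
  show ?case
    unfolding Ck_on.simps
  proof (rule continuous_at_imp_continuous_on, rule ballI)
    fix x assume "x \<in> S"
    with 0 obtain T where "open T" "x \<in> T" "continuous_on T f" by auto
    then show "isCont f x" by (simp add: continuous_on_eq_continuous_at)
  qed
next
  case (Suc k)
  show ?case
    unfolding Ck_on.simps
  proof (intro conjI ballI allI)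
    fix x assume "x \<in> S"
    then show "f differentiable at x" using Suc.prems by fastforce
  next
    fix v
    show "Ck_on k S (\<lambda>x. frechet_derivative f (at x) v)"
      by (rule Suc.IH) (use Suc.prems in fastforce)
  qed
qed

lemma Ck_on_cong:
  assumes "open S" "Ck_on k S f" "\<And>x. x \<in> S \<Longrightarrow> f x = g x"
  shows "Ck_on k S g"
  using assms(2,3)
proof (induction k arbitrary: f g)
  case 0
  then show ?case by (simp cong: continuous_on_cong)
next
  case (Suc k)
  have D: "(g has_derivative frechet_derivative f (at x)) (at x)" if "x \<in> S" for x
  proof (rule has_derivative_transform_within_open)
    show "(f has_derivative frechet_derivative f (at x)) (at x)"
      using Suc.prems(1) that by (simp add: frechet_derivative_works)
  qed (use assms(1) that Suc.prems in auto)
  have "Ck_on k S (\<lambda>x. frechet_derivative g (at x) v)" for v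
  proof (rule Suc.IH)
    show "Ck_on k S (\<lambda>x. frechet_derivative f (at x) v)" using Suc.prems by simp
  qed (use frechet_derivative_at[OF D] in simp)
  then show ?case using D by (auto simp: differentiable_def)
qed

text \<open>The definition of \<open>Ck_on\<close> speaks of \<open>frechet_derivative\<close>, a
  choice term; by uniqueness of derivatives any explicit formula may take its place.\<close>

lemma Ck_on_SucI:
  assumes "open S" "\<And>x. x \<in> S \<Longrightarrow> (f has_derivative f' x) (at x)"
    and "\<And>v. Ck_on k S (\<lambda>x. f' x v)"
  shows "Ck_on (Suc k) S f"
  unfolding Ck_on.simps
proof (intro conjI ballI allI)
  fix v
  show "Ck_on k S (\<lambda>x. frechet_derivative f (at x) v)"
    by (rule Ck_on_cong[OF assms(1) assms(3)]) (use frechet_derivative_at[OF assms(2)] in simp)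
qed (use assms(2) in \<open>auto simp: differentiable_def\<close>)

lemma Ck_on_SucD:
  assumes "Ck_on (Suc k) S f"
  shows "\<And>x. x \<in> S \<Longrightarrow> (f has_derivative frechet_derivative f (at x)) (at x)"
    and "\<And>v. Ck_on k S (\<lambda>x. frechet_derivative f (at x) v)"
  using assms by (auto simp: frechet_derivative_works)

lemma Ck_on_Suc_imp: "Ck_on (Suc k) S f \<Longrightarrow> Ck_on k S f"
proof (induction k arbitrary: f)
  case 0
  then show ?case
    by (auto intro!: continuous_at_imp_continuous_on differentiable_imp_continuous_within)
next
  case (Suc k)
  then have "\<forall>x\<in>S. f differentiable at x" and "\<forall>v. Ck_on (Suc k) S (\<lambda>x. frechet_derivative f (at x) v)"
    using Ck_on.simps(2)[of "Suc k" S f] by blast+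
  with Suc.IH show ?case by (simp only: Ck_on.simps(2)) blast
qed

section \<open>Closure properties of the class C^k\<close>

lemma Ck_on_const: "open S \<Longrightarrow> Ck_on k S (\<lambda>x. c)"
proof (induction k arbitrary: c)
  case (Suc k)
  show ?case
    by (rule Ck_on_SucI[where f' = "\<lambda>_ _. 0"]) (use Suc in auto)
qed simp

lemma Ck_on_bounded_linear_comp:
  assumes "open S" "bounded_linear h" "Ck_on k S f"
  shows "Ck_on k S (\<lambda>x. h (f x))"
  using assms(3)
proof (induction k arbitrary: f)
  case 0
  then show ?case
    by (auto intro: bounded_linear.continuous_on[OF assms(2)])
next
  case (Suc k)
  note D = Ck_on_SucD[OF Suc.prems]
  show ?case
    by (rule Ck_on_SucI[where f' = "\<lambda>x v. h (frechet_derivative f (at x) v)"])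
      (use assms(1) D Suc.IH in \<open>auto intro: bounded_linear.has_derivative[OF assms(2)]\<close>)
qed

lemma Ck_on_bounded_linear:
  assumes "open S" "bounded_linear h"
  shows "Ck_on k S h"
proof (cases k)
  case 0
  then show ?thesis using linear_continuous_on[OF assms(2)] by simp
next
  case (Suc n)
  have "Ck_on (Suc n) S h"
    by (rule Ck_on_SucI[where f' = "\<lambda>_. h"])
      (use assms in \<open>auto intro: bounded_linear_imp_has_derivative Ck_on_const\<close>)
  with Suc show ?thesis by simp
qed

lemma Ck_on_add:
  assumes "open S" "Ck_on k S f" "Ck_on k S g"
  shows "Ck_on k S (\<lambda>x. f x + g x)"
  using assms(2,3)
proof (induction k arbitrary: f g)
  case 0
  then show ?case by (auto intro: continuous_intros)
next
  case (Suc k)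
  note D = Ck_on_SucD[OF Suc.prems(1)] Ck_on_SucD[OF Suc.prems(2)]
  show ?case
    by (rule Ck_on_SucI[where f' = "\<lambda>x v. frechet_derivative f (at x) v + frechet_derivative g (at x) v"])
      (use assms(1) D Suc.IH in \<open>auto intro: has_derivative_add\<close>)
qed

lemma Ck_on_sum:
  assumes "open S" "\<And>i. i \<in> I \<Longrightarrow> Ck_on k S (f i)"
  shows "Ck_on k S (\<lambda>x. \<Sum>i\<in>I. f i x)"
  using assms(2)
  by (induction I rule: infinite_finite_induct) (auto intro: Ck_on_const Ck_on_add assms(1))

lemma Ck_on_scaleR:
  assumes "open S" "Ck_on k S f" "Ck_on k S g"
  shows "Ck_on k S (\<lambda>x. f x *\<^sub>R g x)"
  using assms(2,3)
proof (induction k arbitrary: f g)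
  case 0
  then show ?case by (auto intro: continuous_intros)
next
  case (Suc k)
  note D = Ck_on_SucD[OF Suc.prems(1)] Ck_on_SucD[OF Suc.prems(2)]
  note L = Suc.prems[THEN Ck_on_Suc_imp]
  show ?case
    by (rule Ck_on_SucI[where f' = "\<lambda>x v. f x *\<^sub>R frechet_derivative g (at x) v + frechet_derivative f (at x) v *\<^sub>R g x"])
      (use assms(1) D Suc.IH L in \<open>auto intro: has_derivative_scaleR Ck_on_add\<close>)
qed

lemma Ck_on_Pair:
  assumes "open S" "Ck_on k S f" "Ck_on k S g"
  shows "Ck_on k S (\<lambda>x. (f x, g x))"
proof -
  have "Ck_on k S (\<lambda>x. (f x, 0) + (0, g x))"
    by (intro Ck_on_add Ck_on_bounded_linear_comp[of S "\<lambda>y. (y, 0)"]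
        Ck_on_bounded_linear_comp[of S "\<lambda>y. (0, y)"] assms bounded_linear_Pair
        bounded_linear_ident bounded_linear_zero)
  then show ?thesis by simp
qed

text \<open>The map \<open>f\<close> stays fixed while the induction generalises \<open>g\<close>.
  Expanded in the basis, the chain rule gives a sum of scalars \<open>?f' x v \<bullet> b\<close>
  times partial derivatives of \<open>g\<close> composed with \<open>f\<close>; the induction
  hypothesis covers the latter.\<close>

lemma Ck_on_compose:
  assumes "open S" "Ck_on k S f" "Ck_on k T g" "f ` S \<subseteq> T"
  shows "Ck_on k S (\<lambda>x. g (f x))"
  using assms(2,3)
proof (induction k arbitrary: g)
  case 0
  then show ?case using assms(4) by (auto intro: continuous_on_compose2)
next
  case (Suc k)
  note Df = Ck_on_SucD[OF Suc.prems(1)] and Dg = Ck_on_SucD[OF Suc.prems(2)]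
  let ?f' = "\<lambda>x. frechet_derivative f (at x)" and ?g' = "\<lambda>y. frechet_derivative g (at y)"
  show ?case
  proof (rule Ck_on_SucI[where f' = "\<lambda>x v. \<Sum>b\<in>Basis. (?f' x v \<bullet> b) *\<^sub>R ?g' (f x) b"])
    fix x assume x: "x \<in> S"
    have D: "((\<lambda>x. g (f x)) has_derivative (\<lambda>v. ?g' (f x) (?f' x v))) (at x)"
      by (rule has_derivative_compose[OF Df(1)[OF x]]) (use Dg(1) x assms(4) in auto)
    have lin: "linear (?g' (f x))"
      using Dg(1)[of "f x"] x assms(4) has_derivative_linear by blast
    have rep: "?g' (f x) w = (\<Sum>b\<in>Basis. (w \<bullet> b) *\<^sub>R ?g' (f x) b)" for w
      by (subst euclidean_representation[symmetric, of w])
        (simp add: linear_sum[OF lin] linear_cmul[OF lin])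
    have "(\<lambda>v. ?g' (f x) (?f' x v)) = (\<lambda>v. \<Sum>b\<in>Basis. (?f' x v \<bullet> b) *\<^sub>R ?g' (f x) b)"
      by (rule ext, rule rep)
    with D show "((\<lambda>x. g (f x)) has_derivative (\<lambda>v. \<Sum>b\<in>Basis. (?f' x v \<bullet> b) *\<^sub>R ?g' (f x) b)) (at x)"
      by (simp only:)
  next
    fix v
    have 1: "Ck_on k S (\<lambda>x. ?f' x v \<bullet> b)" for b
      by (rule Ck_on_bounded_linear_comp[OF assms(1) bounded_linear_inner_left Df(2)])
    have 2: "Ck_on k S (\<lambda>x. ?g' (f x) b)" for b
      by (rule Suc.IH[OF Ck_on_Suc_imp[OF Suc.prems(1)] Dg(2)])
    show "Ck_on k S (\<lambda>x. \<Sum>b\<in>Basis. (?f' x v \<bullet> b) *\<^sub>R ?g' (f x) b)"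
      by (rule Ck_on_sum[OF assms(1) Ck_on_scaleR[OF assms(1) 1 2]])
  qed (rule assms(1))
qed

section \<open>Smooth maps and their derivatives\<close>

lemma smooth_on_compose:
  assumes "open S" "smooth_on S f" "smooth_on T g" "f ` S \<subseteq> T"
  shows "smooth_on S (\<lambda>x. g (f x))"
  unfolding smooth_on_def
proof
  fix k
  show "Ck_on k S (\<lambda>x. g (f x))"
    by (rule Ck_on_compose[OF assms(1) _ _ assms(4)]) (use assms in \<open>simp_all only: smooth_on_def\<close>)
qed

lemma smooth_on_Pair:
  assumes "open S" "smooth_on S f" "smooth_on S g"
  shows "smooth_on S (\<lambda>x. (f x, g x))"
  using assms by (simp add: smooth_on_def Ck_on_Pair)

lemma smooth_on_bounded_linear:
  "open S \<Longrightarrow> bounded_linear h \<Longrightarrow> smooth_on S h"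
  by (simp add: smooth_on_def Ck_on_bounded_linear)

lemma smooth_on_const: "open S \<Longrightarrow> smooth_on S (\<lambda>x. c)"
  by (simp add: smooth_on_def Ck_on_const)

lemma smooth_on_subset: "smooth_on S f \<Longrightarrow> T \<subseteq> S \<Longrightarrow> smooth_on T f"
  by (auto simp: smooth_on_def intro: Ck_on_subset)

lemma smooth_on_cong:
  assumes "open S" "smooth_on S f" "\<And>x. x \<in> S \<Longrightarrow> f x = g x"
  shows "smooth_on S g"
  using assms(2) Ck_on_cong[OF assms(1) _ assms(3)] by (simp add: smooth_on_def)

lemma smooth_on_local:
  assumes "\<And>x. x \<in> S \<Longrightarrow> \<exists>T. open T \<and> x \<in> T \<and> smooth_on T f"
  shows "smooth_on S f"
  unfolding smooth_on_def
proof
  fix k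
  show "Ck_on k S f"
    by (rule Ck_on_local) (use assms in \<open>auto simp: smooth_on_def\<close>)
qed

lemma smooth_on_imp_has_derivative:
  assumes "smooth_on S f" "x \<in> S"
  shows "(f has_derivative frechet_derivative f (at x)) (at x)"
  using assms Ck_on_SucD(1)[of 0 S f x] by (simp add: smooth_on_def del: Ck_on.simps)

lemma smooth_on_frechet_derivative:
  assumes "smooth_on S f"
  shows "smooth_on S (\<lambda>x. frechet_derivative f (at x) v)"
  unfolding smooth_on_def
proof
  fix k
  show "Ck_on k S (\<lambda>x. frechet_derivative f (at x) v)"
    by (rule Ck_on_SucD(2)) (use assms in \<open>simp only: smooth_on_def\<close>)
qed

lemma has_vector_derivative_along_line:
  assumes "(F has_derivative D) (at z)"
  shows "((\<lambda>t. F (z + t *\<^sub>R v)) has_vector_derivative D v) (at 0)"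
proof -
  have "((\<lambda>t::real. z + t *\<^sub>R v) has_derivative (\<lambda>h. h *\<^sub>R v)) (at 0)"
    by (auto intro!: derivative_eq_intros)
  then have "((\<lambda>t. F (z + t *\<^sub>R v)) has_derivative (\<lambda>h. D (h *\<^sub>R v))) (at 0)"
    by (rule has_derivative_compose) (use assms in simp)
  moreover have "D (h *\<^sub>R v) = h *\<^sub>R D v" for h
    using has_derivative_linear[OF assms] by (rule linear_cmul)
  ultimately show ?thesis by (simp add: has_vector_derivative_def)
qed

text \<open>For real functions the Frechet derivative in direction \<open>1\<close> is
  \<open>deriv\<close>, in which the convexity condition of \<open>kempf_ness\<close> is phrased;
  smoothness of \<open>deriv f\<close> allows a second differentiation.\<close>

lemma smooth_on_real_deriv:
  fixes f :: "real \<Rightarrow> real"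
  assumes "smooth_on UNIV f"
  shows "(f has_real_derivative deriv f t) (at t)" and "smooth_on UNIV (deriv f)"
proof -
  have d: "(f has_derivative frechet_derivative f (at t)) (at t)" for t
    by (rule smooth_on_imp_has_derivative[OF assms]) simp
  have eq: "(f has_real_derivative frechet_derivative f (at t) 1) (at t)" for t
  proof -
    have "h * frechet_derivative f (at t) 1 = frechet_derivative f (at t) h" for h
      using linear_cmul[OF has_derivative_linear[OF d], of t h 1] by simp
    with d show ?thesis by (rule has_derivative_imp_has_field_derivative)
  qed
  then have deriv: "deriv f = (\<lambda>t. frechet_derivative f (at t) 1)"
    by (intro ext DERIV_imp_deriv)
  show "(f has_real_derivative deriv f t) (at t)" using eq by (simp add: deriv)
  show "smooth_on UNIV (deriv f)" unfolding deriv by (rule smooth_on_frechet_derivative[OF assms])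
qed

section \<open>Smooth maps from Euclidean spaces to manifolds\<close>

text \<open>The part of the atlas axioms that computations in charts rely on. It passes to products
  and holds for \<open>euclidean_atlas\<close>, so the multiplication map on a product atlas fits
  the same composition lemma.\<close>

definition chart_cover :: "('a::topological_space, 'e) chart set \<Rightarrow> bool" where
  "chart_cover \<B> \<longleftrightarrow> (\<Union>(U, \<phi>)\<in>\<B>. U) = UNIV \<and> (\<forall>(U, \<phi>)\<in>\<B>. open U \<and> inj_on \<phi> U)"

lemma chart_cover_smooth_atlas: "smooth_atlas \<B> \<Longrightarrow> chart_cover \<B>"
  unfolding smooth_atlas_def chart_cover_def homeomorphism_def
  by (fastforce intro!: inj_on_inverseI)

lemma chart_cover_euclidean: "chart_cover euclidean_atlas"
  by (simp add: chart_cover_def euclidean_atlas_def)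

lemma chart_cover_obtain:
  assumes "chart_cover \<B>"
  obtains U \<phi> where "(U, \<phi>) \<in> \<B>" "x \<in> U"
proof -
  have "x \<in> (\<Union>(U, \<phi>)\<in>\<B>. U)" using assms by (simp add: chart_cover_def)
  then show thesis using that by blast
qed

lemma chart_coverD:
  assumes "chart_cover \<B>" "(U, \<phi>) \<in> \<B>"
  shows "open U" "inj_on \<phi> U"
  using assms by (auto simp: chart_cover_def)

lemma chart_cover_product:
  assumes "chart_cover \<B>" "chart_cover \<C>"
  shows "chart_cover (product_atlas \<B> \<C>)"
  unfolding chart_cover_def
proof (intro conjI)
  show "(\<Union>(U, \<phi>)\<in>product_atlas \<B> \<C>. U) = UNIV"
  proof (rule UNIV_eq_I[symmetric])
    fix z :: "'a \<times> 'c"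
    obtain U \<phi> where U: "(U, \<phi>) \<in> \<B>" "fst z \<in> U" using chart_cover_obtain[OF assms(1)] by blast
    obtain V \<rho> where V: "(V, \<rho>) \<in> \<C>" "snd z \<in> V" using chart_cover_obtain[OF assms(2)] by blast
    have "(U \<times> V, map_prod \<phi> \<rho>) \<in> product_atlas \<B> \<C>"
      using U V by (auto simp: product_atlas_def)
    moreover have "z \<in> U \<times> V" using U V by (simp add: mem_Times_iff)
    ultimately show "z \<in> (\<Union>(U, \<phi>)\<in>product_atlas \<B> \<C>. U)" by blast
  qed
  show "\<forall>(U, \<phi>)\<in>product_atlas \<B> \<C>. open U \<and> inj_on \<phi> U"
    using chart_coverD[OF assms(1)] chart_coverD[OF assms(2)]
    by (auto simp: product_atlas_def intro!: open_Times map_prod_inj_on)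
qed

lemma smooth_map_euclidean_iff:
  "smooth_map euclidean_atlas \<B> f \<longleftrightarrow>
     continuous_on UNIV f \<and> (\<forall>(V, \<rho>)\<in>\<B>. smooth_on (f -` V) (\<lambda>z. \<rho> (f z)))"
proof -
  have "inv_into UNIV (id :: 'a \<Rightarrow> 'a) = id" by (rule inv_id)
  then show ?thesis by (simp add: smooth_map_def euclidean_atlas_def comp_def)
qed

lemma smooth_map_euclideanI:
  assumes "continuous_on UNIV f"
    and "\<And>V \<rho>. (V, \<rho>) \<in> \<B> \<Longrightarrow> smooth_on (f -` V) (\<lambda>z. \<rho> (f z))"
  shows "smooth_map euclidean_atlas \<B> f"
  using assms by (auto simp: smooth_map_euclidean_iff)

text \<open>Around each point a chart \<open>\<phi>\<close> of the middle manifold is inserted,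
  which writes the composite as the chart representation of \<open>g\<close> after
  \<open>\<phi> \<circ> f\<close>. The source being Euclidean, the pieces \<open>?T\<close> are open
  sets to which the calculus above applies.\<close>

lemma smooth_map_euclidean_compose:
  assumes f: "smooth_map euclidean_atlas \<B> f" and g: "smooth_map \<B> \<C> g"
    and "chart_cover \<B>" "chart_cover \<C>"
  shows "smooth_map euclidean_atlas \<C> (\<lambda>z. g (f z))"
proof (rule smooth_map_euclideanI)
  have cf: "continuous_on UNIV f" and cg: "continuous_on UNIV g"
    using f g by (auto simp: smooth_map_def)
  show cgf: "continuous_on UNIV (\<lambda>z. g (f z))"
    by (rule continuous_on_compose2[OF cg cf]) simp
  fix W \<rho> assume W: "(W, \<rho>) \<in> \<C>"
  show "smooth_on ((\<lambda>z. g (f z)) -` W) (\<lambda>z. \<rho> (g (f z)))"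
  proof (rule smooth_on_local)
    fix z assume z: "z \<in> (\<lambda>z. g (f z)) -` W"
    obtain V \<phi> where V: "(V, \<phi>) \<in> \<B>" "f z \<in> V" using chart_cover_obtain[OF assms(3)] by blast
    let ?T = "f -` V \<inter> (\<lambda>z. g (f z)) -` W"
    have T: "open ?T"
      using chart_coverD(1)[OF assms(3) V(1)] chart_coverD(1)[OF assms(4) W] cf cgf
      by (intro open_Int open_vimage)
    have "smooth_on (f -` V) (\<lambda>z. \<phi> (f z))"
      using f V(1) by (auto simp: smooth_map_euclidean_iff)
    then have 1: "smooth_on ?T (\<lambda>z. \<phi> (f z))" by (rule smooth_on_subset) simp
    have 2: "smooth_on (\<phi> ` (V \<inter> g -` W)) (\<rho> \<circ> g \<circ> inv_into V \<phi>)"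
      using g V(1) W unfolding smooth_map_def by blast
    have "smooth_on ?T (\<lambda>z. (\<rho> \<circ> g \<circ> inv_into V \<phi>) (\<phi> (f z)))"
      by (rule smooth_on_compose[OF T 1 2]) auto
    then have "smooth_on ?T (\<lambda>z. \<rho> (g (f z)))"
      by (rule smooth_on_cong[OF T]) (simp add: inv_into_f_f[OF chart_coverD(2)[OF assms(3) V(1)]])
    then show "\<exists>T. open T \<and> z \<in> T \<and> smooth_on T (\<lambda>z. \<rho> (g (f z)))"
      using T z V(2) by (intro exI[of _ ?T]) simp
  qed
qed

lemma smooth_map_euclidean_Pair:
  assumes f: "smooth_map euclidean_atlas \<B> f" and g: "smooth_map euclidean_atlas \<C> g"
    and "chart_cover \<B>" "chart_cover \<C>"
  shows "smooth_map euclidean_atlas (product_atlas \<B> \<C>) (\<lambda>z. (f z, g z))"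
proof (rule smooth_map_euclideanI)
  have cf: "continuous_on UNIV f" and cg: "continuous_on UNIV g"
    using f g by (auto simp: smooth_map_def)
  then show "continuous_on UNIV (\<lambda>z. (f z, g z))" by (intro continuous_on_Pair)
  fix W \<rho> assume "(W, \<rho>) \<in> product_atlas \<B> \<C>"
  then obtain U \<phi> V \<theta> where UV: "(U, \<phi>) \<in> \<B>" "(V, \<theta>) \<in> \<C>" and W: "W = U \<times> V" "\<rho> = map_prod \<phi> \<theta>"
    by (auto simp: product_atlas_def)
  have eq: "(\<lambda>z. (f z, g z)) -` W = f -` U \<inter> g -` V" by (auto simp: W)
  have T: "open (f -` U \<inter> g -` V)"
    using chart_coverD(1)[OF assms(3) UV(1)] chart_coverD(1)[OF assms(4) UV(2)] cf cg
    by (intro open_Int open_vimage)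
  have 1: "smooth_on (f -` U) (\<lambda>z. \<phi> (f z))" and 2: "smooth_on (g -` V) (\<lambda>z. \<theta> (g z))"
    using f g UV by (auto simp: smooth_map_euclidean_iff)
  show "smooth_on ((\<lambda>z. (f z, g z)) -` W) (\<lambda>z. \<rho> (f z, g z))"
    unfolding eq unfolding W map_prod_simp
    by (rule smooth_on_Pair[OF T smooth_on_subset[OF 1] smooth_on_subset[OF 2]]) auto
qed

lemma smooth_map_bounded_linear:
  "bounded_linear L \<Longrightarrow> smooth_map euclidean_atlas euclidean_atlas L"
  unfolding smooth_map_euclidean_iff
  by (simp add: euclidean_atlas_def linear_continuous_on smooth_on_bounded_linear)

lemma smooth_map_const:
  "smooth_map euclidean_atlas \<B> (\<lambda>z. c)"
proof (rule smooth_map_euclideanI)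
  fix V \<rho>
  show "smooth_on ((\<lambda>z. c) -` V) (\<lambda>z. \<rho> c)"
    by (rule smooth_on_const) (cases "c \<in> V"; simp)
qed simp

section \<open>Commuting exponentials\<close>

sublocale lie_group \<subseteq> group G
  by (rule group_G)

context lie_group
begin

declare carrier_G [simp]

lemma chart_cover_atlas: "chart_cover \<A>"
  by (rule chart_cover_smooth_atlas[OF atlas])

lemma smooth_map_mult:
  assumes "smooth_map euclidean_atlas \<A> f" "smooth_map euclidean_atlas \<A> g"
  shows "smooth_map euclidean_atlas \<A> (\<lambda>z. f z \<otimes> g z)"
  using smooth_map_euclidean_compose[OF smooth_map_euclidean_Pair[OF assms chart_cover_atlas chart_cover_atlas]
      smooth_mult chart_cover_product[OF chart_cover_atlas chart_cover_atlas] chart_cover_atlas]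
  by simp

text \<open>By continuity the preimage of the domain of \<open>\<kappa>\<close> is open, and it
  contains every point sent to the identity; velocities there can therefore be computed with
  \<open>\<kappa>\<close>.\<close>

lemma smooth_on_chart_one:
  assumes "smooth_map euclidean_atlas \<A> f"
  obtains T where "open T" "\<And>z. f z = \<one> \<Longrightarrow> z \<in> T" "smooth_on T (\<lambda>z. \<kappa> (f z))"
proof -
  obtain U where U: "(U, \<kappa>) \<in> \<A>" "\<one> \<in> U" using chart_one by blast
  have "open (f -` U)"
    using assms chart_coverD(1)[OF chart_cover_atlas U(1)] by (intro open_vimage) (auto simp: smooth_map_def)
  moreover have "smooth_on (f -` U) (\<lambda>z. \<kappa> (f z))"
    using assms U(1) by (auto simp: smooth_map_euclidean_iff)
  ultimately show thesis using that[of "f -` U"] U(2) by simp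
qed

lemma has_derivative_chart_one:
  assumes "smooth_map euclidean_atlas \<A> f" "f z = \<one>"
  obtains D where "((\<lambda>z. \<kappa> (f z)) has_derivative D) (at z)"
  using smooth_on_chart_one[OF assms(1)] smooth_on_imp_has_derivative assms(2) by metis

lemma inv_mult_cancel: "inv g \<otimes> (g \<otimes> h) = h"
  by (simp add: m_assoc[symmetric])

lemma conj_mult: "(g \<otimes> a \<otimes> inv g) \<otimes> (g \<otimes> b \<otimes> inv g) = g \<otimes> (a \<otimes> b) \<otimes> inv g"
  by (simp add: m_assoc inv_mult_cancel)

end

context real_reductive_group
begin

section \<open>Exponential map and one-parameter subgroups\<close>

lemma exp_zero: "ex 0 = \<one>"
proof -
  have "ex ((0 + 0) *\<^sub>R 0) = ex (0 *\<^sub>R 0) \<otimes> ex (0 *\<^sub>R 0)"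
    using exponential unfolding exponential_map_def by blast
  then show ?thesis by (simp add: l_cancel_one')
qed

lemma exp_scale_add: "ex ((s + t) *\<^sub>R \<xi>) = ex (s *\<^sub>R \<xi>) \<otimes> ex (t *\<^sub>R \<xi>)"
  using exponential unfolding exponential_map_def by blast

lemma exp_derivative: "((\<lambda>t. \<kappa> (ex (t *\<^sub>R \<xi>))) has_vector_derivative \<xi>) (at 0)"
  using exponential unfolding exponential_map_def by blast

lemma inv_exp: "inv (ex \<xi>) = ex (- \<xi>)"
proof -
  have "ex (- \<xi>) \<otimes> ex \<xi> = \<one>"
    using exp_scale_add[of "-1" 1 \<xi>] by (simp add: exp_zero)
  then show ?thesis by (intro inv_equality) auto
qed

text \<open>\<open>exponential_map\<close> asserts smoothness only along lines. Joint smoothness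
  comes from the Cartan map \<open>(g, \<xi>) \<mapsto> g \<otimes> ex \<xi>\<close>, restricted to
  \<open>g = \<one>\<close>.\<close>

lemma smooth_map_exp:
  assumes "bounded_linear L"
  shows "smooth_map euclidean_atlas \<A> (\<lambda>z. ex (L z))"
proof -
  have "smooth_map (product_atlas \<A> euclidean_atlas) \<A> (\<lambda>(g, \<xi>). g \<otimes> ex \<xi>)"
    using cartan_diffeomorphism by blast
  from smooth_map_euclidean_compose[OF smooth_map_euclidean_Pair[OF smooth_map_const[of \<A> \<one>]
        smooth_map_bounded_linear[OF assms] chart_cover_atlas chart_cover_euclidean] this
      chart_cover_product[OF chart_cover_atlas chart_cover_euclidean] chart_cover_atlas]
  show ?thesis by simp
qed

text \<open>
  Near the identity \<open>c t = ex (\<zeta> t)\<close>, and \<open>c t = (c (t / 2))\<^sup>2\<close> gives \<open>\<zeta> t = 2 \<zeta> (t / 2)\<close> by local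
  injectivity of the exponential map; iterating, \<open>\<zeta> t = t \<zeta>' 0\<close>.
\<close>

lemma one_parameter_subgroup_unique:
  assumes hom: "\<And>s t. c (s + t) = c s \<otimes> c t"
    and cont: "continuous_on UNIV c"
    and der: "((\<lambda>t. \<kappa> (c t)) has_vector_derivative \<xi>) (at 0)"
  shows "c t = ex (t *\<^sub>R \<xi>)"
proof -
  have c0: "c 0 = \<one>" using hom[of 0 0] by (simp add: l_cancel_one')
  obtain U where U: "(U, \<kappa>) \<in> \<A>" "\<one> \<in> U" using chart_one by blast
  have openU: "open U" and injU: "inj_on \<kappa> U" using chart_coverD[OF chart_cover_atlas U(1)] by auto
  have sm: "smooth_map euclidean_atlas \<A> ex"
    using smooth_map_exp[OF bounded_linear_ident] by simp
  \<comment> \<open>The exponential map in the chart \<open>\<kappa>\<close>; its derivative is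
    packaged as a bounded linear function because the inverse function theorem asks for a continuous
    family of these.\<close>
  define E where "E = (\<lambda>z. \<kappa> (ex z))"
  define E' where "E' = (\<lambda>z. Blinfun (frechet_derivative E (at z)))"
  let ?W = "ex -` U"
  have openW: "open ?W" using sm openU by (intro open_vimage) (auto simp: smooth_map_def)
  have W0: "0 \<in> ?W" using U(2) by (simp add: exp_zero)
  have smE: "smooth_on ?W E"
    using sm U(1) unfolding E_def by (auto simp: smooth_map_euclidean_iff)
  have dE: "(E has_derivative frechet_derivative E (at z)) (at z)" if "z \<in> ?W" for z
    by (rule smooth_on_imp_has_derivative[OF smE that])
  have E'_apply: "blinfun_apply (E' z) = frechet_derivative E (at z)" if "z \<in> ?W" for z
    unfolding E'_def by (rule bounded_linear_Blinfun_apply[OF has_derivative_bounded_linear[OF dE[OF that]]])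
  have contE': "continuous_on ?W E'"
  proof (rule continuous_on_blinfun_componentwise)
    fix i :: 'e
    have "Ck_on 0 ?W (\<lambda>z. frechet_derivative E (at z) i)"
      using smooth_on_frechet_derivative[OF smE] unfolding smooth_on_def by blast
    then have "continuous_on ?W (\<lambda>z. frechet_derivative E (at z) i)" by simp
    then show "continuous_on ?W (\<lambda>z. blinfun_apply (E' z) i)"
      by (rule continuous_on_eq) (simp add: E'_apply)
  qed
  \<comment> \<open>\<open>exponential_map\<close> prescribes the velocity along each line, so the
    derivative at \<open>0\<close> is the identity, hence invertible.\<close>
  have E'0: "blinfun_apply (E' 0) v = v" for v
    using has_vector_derivative_along_line[OF dE[OF W0], of v] exp_derivative[of v]
      vector_derivative_unique_at
    by (fastforce simp: E'_apply[OF W0] E_def)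
  have dE': "(E has_derivative blinfun_apply (E' z)) (at z)" if "z \<in> ?W" for z
    using dE[OF that] by (simp add: E'_apply[OF that])
  have inv0: "id_blinfun o\<^sub>L E' 0 = id_blinfun"
    by (rule blinfun_eqI) (simp add: E'0)
  obtain U' V g g' where U': "open U'" "U' \<subseteq> ?W" "0 \<in> U'" and V: "open V" "E 0 \<in> V"
    and homeo: "homeomorphism U' V E g"
    and dg: "\<And>y. y \<in> V \<Longrightarrow> (g has_derivative g' y) (at y)"
      "\<And>y. y \<in> V \<Longrightarrow> g' y = inv_into UNIV (blinfun_apply (E' (g y)))"
    using inverse_function_theorem[OF openW dE' contE' W0 inv0] by metis
  have gE: "g (E z) = z" if "z \<in> U'" for z using homeo that by (simp add: homeomorphism_def)
  have Eg: "E (g y) = y" if "y \<in> V" for y using homeo that by (simp add: homeomorphism_def)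
  have gE0: "g (E 0) = 0" using gE U'(3) by simp
  have "blinfun_apply (E' 0) = id" using E'0 by auto
  then have g'0: "g' (E 0) = id" using dg(2)[OF V(2)] gE0 by (simp add: inv_id)
  have E0: "E 0 = \<kappa> (c 0)" by (simp add: E_def exp_zero c0)
  obtain r where r: "0 < r" "ball 0 r \<subseteq> U'" using U'(1,3) open_contains_ball by blast
  \<comment> \<open>The local logarithm of \<open>c\<close>: near \<open>0\<close> its exponential
    is \<open>c\<close>, and its derivative at \<open>0\<close> is \<open>\<xi>\<close>.\<close>
  define \<zeta> where "\<zeta> = (\<lambda>t. g (\<kappa> (c t)))"
  have \<zeta>0: "\<zeta> 0 = 0" using gE0 by (simp add: \<zeta>_def E0)
  have d\<zeta>: "(\<zeta> has_derivative (\<lambda>h. h *\<^sub>R \<xi>)) (at 0)"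
    using has_derivative_compose[OF der[unfolded has_vector_derivative_def], of g id] dg(1)[OF V(2)]
    unfolding \<zeta>_def g'0 unfolding E0 by simp
  have "\<forall>\<^sub>F t in nhds 0. c t \<in> U"
  proof -
    have "isCont c 0" using cont by (simp add: continuous_on_eq_continuous_at)
    then show ?thesis
      using topological_tendstoD[of c "c 0" "at 0" U] openU U(2)
      by (simp add: isCont_def c0 eventually_nhds_conv_at)
  qed
  moreover have "\<forall>\<^sub>F t in nhds 0. \<kappa> (c t) \<in> V"
  proof -
    have "isCont (\<lambda>t. \<kappa> (c t)) 0" using der by (rule has_vector_derivative_continuous)
    then show ?thesis
      using topological_tendstoD[of "\<lambda>t. \<kappa> (c t)" "\<kappa> (c 0)" "at 0" V] V
      by (simp add: isCont_def E0 eventually_nhds_conv_at)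
  qed
  \<comment> \<open>With radius \<open>r / 2\<close> both \<open>\<zeta> t\<close> and
    \<open>2 *\<^sub>R \<zeta> (t / 2)\<close> lie in \<open>ball 0 r\<close>, where
    \<open>E\<close> is injective.\<close>
  moreover have "\<forall>\<^sub>F t in nhds 0. \<zeta> t \<in> ball 0 (r / 2)"
  proof -
    have "isCont \<zeta> 0" using d\<zeta> by (rule has_derivative_continuous)
    then show ?thesis
      using topological_tendstoD[of \<zeta> "\<zeta> 0" "at 0" "ball 0 (r / 2)"] r(1)
      by (simp add: isCont_def \<zeta>0 eventually_nhds_conv_at del: mem_ball_0)
  qed
  ultimately have "\<forall>\<^sub>F t in nhds 0. c t \<in> U \<and> \<kappa> (c t) \<in> V \<and> \<zeta> t \<in> ball 0 (r / 2)"
    by eventually_elim simp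
  then obtain \<delta> where \<delta>: "0 < \<delta>"
    and near: "\<And>t. \<bar>t\<bar> < \<delta> \<Longrightarrow> c t \<in> U \<and> \<kappa> (c t) \<in> V \<and> norm (\<zeta> t) < r / 2"
    unfolding eventually_nhds_metric by (auto simp: dist_norm)
  have exp_\<zeta>: "ex (\<zeta> t) = c t" if "\<bar>t\<bar> < \<delta>" for t
  proof -
    have "\<zeta> t \<in> U'" using near[OF that] r by auto
    then have "ex (\<zeta> t) \<in> U" using U'(2) by auto
    moreover have "\<kappa> (ex (\<zeta> t)) = \<kappa> (c t)"
      using Eg near[OF that] by (simp add: \<zeta>_def E_def)
    ultimately show ?thesis using injU near[OF that] by (auto dest: inj_onD)
  qed
  have half: "\<zeta> t = 2 *\<^sub>R \<zeta> (t / 2)" if t: "\<bar>t\<bar> < \<delta>" for t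
  proof -
    have t2: "\<bar>t / 2\<bar> < \<delta>" using t by simp
    have "ex (2 *\<^sub>R \<zeta> (t / 2)) = ex (\<zeta> (t / 2)) \<otimes> ex (\<zeta> (t / 2))"
      using exp_scale_add[of 1 1 "\<zeta> (t / 2)"] by simp
    also have "\<dots> = ex (\<zeta> t)"
      using hom[of "t / 2" "t / 2"] by (simp add: exp_\<zeta>[OF t2] exp_\<zeta>[OF t])
    finally have "E (2 *\<^sub>R \<zeta> (t / 2)) = E (\<zeta> t)" by (simp add: E_def)
    moreover have "2 *\<^sub>R \<zeta> (t / 2) \<in> U'" "\<zeta> t \<in> U'"
      using near[OF t] near[OF t2] r by auto
    ultimately show ?thesis using gE by metis
  qed
  have halves: "\<zeta> t = 2 ^ n *\<^sub>R \<zeta> (t / 2 ^ n)" if "\<bar>t\<bar> < \<delta>" for t n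
  proof (induction n)
    case (Suc n)
    have "\<bar>t / 2 ^ n\<bar> \<le> \<bar>t\<bar>" by (simp add: divide_le_eq mult_le_cancel_left1)
    with that have "\<zeta> (t / 2 ^ n) = 2 *\<^sub>R \<zeta> (t / 2 ^ n / 2)" by (intro half) simp
    with Suc show ?case by (simp add: mult.commute)
  qed simp
  have lin: "\<zeta> t = t *\<^sub>R \<xi>" if t: "\<bar>t\<bar> < \<delta>" for t
  proof -
    have "norm (\<zeta> t - t *\<^sub>R \<xi>) \<le> e" if "0 < e" for e
    proof -
      \<comment> \<open>Scaling back by \<open>2 ^ n\<close> turns the relative error
        \<open>e'\<close> at \<open>t / 2 ^ n\<close> into \<open>e' * \<bar>t\<bar>\<close>; the
        summand \<open>1\<close> keeps the denominator positive at \<open>t = 0\<close>.\<close>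
      define e' where "e' = e / (\<bar>t\<bar> + 1)"
      have "0 < e'" using that by (simp add: e'_def add_nonneg_pos)
      then obtain d where d: "0 < d" "\<And>h. \<bar>h\<bar> < d \<Longrightarrow> norm (\<zeta> h - h *\<^sub>R \<xi>) \<le> e' * \<bar>h\<bar>"
        using d\<zeta> \<zeta>0 unfolding has_derivative_at_alt by force
      obtain n where n: "\<bar>t\<bar> / d < 2 ^ n" using real_arch_pow[of 2 "\<bar>t\<bar> / d"] by auto
      then have "\<bar>t / 2 ^ n\<bar> < d" using d(1) by (simp add: field_simps)
      then have *: "norm (\<zeta> (t / 2 ^ n) - (t / 2 ^ n) *\<^sub>R \<xi>) \<le> e' * \<bar>t / 2 ^ n\<bar>" by (rule d(2))
      have "\<zeta> t - t *\<^sub>R \<xi> = 2 ^ n *\<^sub>R (\<zeta> (t / 2 ^ n) - (t / 2 ^ n) *\<^sub>R \<xi>)"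
        by (subst halves[OF t, of n]) (simp add: scaleR_diff_right)
      then have "norm (\<zeta> t - t *\<^sub>R \<xi>) = 2 ^ n * norm (\<zeta> (t / 2 ^ n) - (t / 2 ^ n) *\<^sub>R \<xi>)" by simp
      also have "\<dots> \<le> 2 ^ n * (e' * \<bar>t / 2 ^ n\<bar>)" using * by (intro mult_left_mono) auto
      also have "\<dots> = e' * \<bar>t\<bar>" by simp
      also have "\<dots> \<le> e" using that by (simp add: e'_def field_simps)
      finally show ?thesis .
    qed
    then have "norm (\<zeta> t - t *\<^sub>R \<xi>) \<le> 0" by (rule field_le_epsilon) simp
    then show ?thesis by simp
  qed
  \<comment> \<open>On both sides, doubling the argument squares the value, so the equality spreads
    from \<open>\<bar>t\<bar> < \<delta>\<close> to all \<open>t\<close>.\<close>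
  have "c t = ex (t *\<^sub>R \<xi>)" if "\<bar>t\<bar> < 2 ^ n * \<delta>" for t n
    using that
  proof (induction n arbitrary: t)
    case 0
    then show ?case using exp_\<zeta> lin by simp
  next
    case (Suc n)
    then have "c (t / 2) = ex ((t / 2) *\<^sub>R \<xi>)" by simp
    then show ?case
      using hom[of "t / 2" "t / 2"] exp_scale_add[of "t / 2" "t / 2" \<xi>] by simp
  qed
  moreover obtain n where "\<bar>t\<bar> / \<delta> < 2 ^ n" using real_arch_pow[of 2 "\<bar>t\<bar> / \<delta>"] by auto
  ultimately show ?thesis using \<delta> by (simp add: field_simps)
qed

section \<open>Conjugation and the adjoint representation\<close>

lemma smooth_map_conj_exp:
  assumes "bounded_linear L"
  shows "smooth_map euclidean_atlas \<A> (\<lambda>z. g \<otimes> ex (L z) \<otimes> inv g)"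
  by (intro smooth_map_mult smooth_map_const smooth_map_exp assms)

text \<open>Conjugation is smooth in \<open>\<zeta>\<close>, so a full derivative exists at
  \<open>0\<close>, and the directional derivatives defining \<open>Ad\<close> are its values. In
  particular \<open>Ad G \<kappa> ex g\<close> is linear.\<close>

lemma Ad_has_derivative: "((\<lambda>\<zeta>. \<kappa> (g \<otimes> ex \<zeta> \<otimes> inv g)) has_derivative Ad G \<kappa> ex g) (at 0)"
proof -
  obtain D where D: "((\<lambda>\<zeta>. \<kappa> (g \<otimes> ex \<zeta> \<otimes> inv g)) has_derivative D) (at 0)"
    using has_derivative_chart_one[OF smooth_map_conj_exp[OF bounded_linear_ident, of g], of 0]
    by (auto simp: exp_zero)
  have "Ad G \<kappa> ex g \<eta> = D \<eta>" for \<eta>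
    unfolding Ad_def using vector_derivative_at[OF has_vector_derivative_along_line[OF D]] by simp
  then have "Ad G \<kappa> ex g = D" by (rule ext)
  with D show ?thesis by simp
qed

lemma Ad_has_vector_derivative:
  "((\<lambda>t. \<kappa> (g \<otimes> ex (t *\<^sub>R \<eta>) \<otimes> inv g)) has_vector_derivative Ad G \<kappa> ex g \<eta>) (at 0)"
  using has_vector_derivative_along_line[OF Ad_has_derivative, of g \<eta>] by simp

text \<open>In \<open>t\<close>, the conjugate is a one-parameter subgroup with initial velocity
  \<open>Ad G \<kappa> ex g \<eta>\<close>, so uniqueness applies.\<close>

lemma conj_exp: "g \<otimes> ex (t *\<^sub>R \<eta>) \<otimes> inv g = ex (t *\<^sub>R Ad G \<kappa> ex g \<eta>)"
proof (rule one_parameter_subgroup_unique[where c = "\<lambda>t. g \<otimes> ex (t *\<^sub>R \<eta>) \<otimes> inv g"])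
  show "g \<otimes> ex ((s + t) *\<^sub>R \<eta>) \<otimes> inv g = (g \<otimes> ex (s *\<^sub>R \<eta>) \<otimes> inv g) \<otimes> (g \<otimes> ex (t *\<^sub>R \<eta>) \<otimes> inv g)" for s t
    by (simp only: conj_mult exp_scale_add)
  show "continuous_on UNIV (\<lambda>t. g \<otimes> ex (t *\<^sub>R \<eta>) \<otimes> inv g)"
    using smooth_map_conj_exp[OF bounded_linear_scaleR_left, of g \<eta>] by (simp add: smooth_map_def)
qed (rule Ad_has_vector_derivative)

lemma Ad_mult: "Ad G \<kappa> ex (g \<otimes> h) \<eta> = Ad G \<kappa> ex g (Ad G \<kappa> ex h \<eta>)"
proof -
  have "(g \<otimes> h) \<otimes> ex (t *\<^sub>R \<eta>) \<otimes> inv (g \<otimes> h) = g \<otimes> ex (t *\<^sub>R Ad G \<kappa> ex h \<eta>) \<otimes> inv g" for t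
    by (simp add: conj_exp[of h, symmetric] inv_mult_group m_assoc)
  then show ?thesis by (simp add: Ad_def)
qed

lemma Ad_one: "Ad G \<kappa> ex \<one> \<eta> = \<eta>"
  using vector_derivative_at[OF exp_derivative[of \<eta>]] by (simp add: Ad_def)

text \<open>\<open>lie_bracket\<close> is a \<open>vector_derivative\<close>, a chosen value that by
  itself does not give differentiability. That is supplied by writing \<open>Ad\<close> along
  \<open>ex (s *\<^sub>R \<xi>)\<close> as a partial derivative at \<open>(s, 0)\<close> of a smooth
  map of two real variables.\<close>

lemma Ad_exp_has_derivative_zero:
  assumes "lie_bracket G \<kappa> ex \<xi> \<eta> = 0"
  shows "((\<lambda>s. Ad G \<kappa> ex (ex (s *\<^sub>R \<xi>)) \<eta>) has_vector_derivative 0) (at 0)"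
proof -
  let ?f = "\<lambda>z :: real \<times> real. ex (fst z *\<^sub>R \<xi>) \<otimes> ex (snd z *\<^sub>R \<eta>) \<otimes> ex ((- fst z) *\<^sub>R \<xi>)"
  let ?F = "\<lambda>z. \<kappa> (?f z)"
  have sm: "smooth_map euclidean_atlas \<A> ?f"
    by (intro smooth_map_mult smooth_map_exp bounded_linear_scaleR_const bounded_linear_minus
        bounded_linear_fst bounded_linear_snd)
  obtain T where "open T" and T: "\<And>z. ?f z = \<one> \<Longrightarrow> z \<in> T" "smooth_on T ?F"
    using smooth_on_chart_one[OF sm] by blast
  have "?f (s, 0) = \<one>" for s
    using exp_scale_add[of s "- s" \<xi>] by (simp add: exp_zero)
  then have T0: "(s, 0) \<in> T" for s by (rule T(1))
  have eq: "Ad G \<kappa> ex (ex (s *\<^sub>R \<xi>)) \<eta> = frechet_derivative ?F (at (s, 0)) (0, 1)" for s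
    using vector_derivative_at[OF has_vector_derivative_along_line[OF
          smooth_on_imp_has_derivative[OF T(2) T0], of s "(0, 1)"]]
    by (simp add: Ad_def inv_exp)
  obtain D where D: "((\<lambda>z. frechet_derivative ?F (at z) (0, 1)) has_derivative D) (at (0, 0))"
    using smooth_on_imp_has_derivative[OF smooth_on_frechet_derivative[OF T(2)] T0] by blast
  have "((\<lambda>s. Ad G \<kappa> ex (ex (s *\<^sub>R \<xi>)) \<eta>) has_vector_derivative D (1, 0)) (at 0)"
    using has_vector_derivative_along_line[OF D, of "(1, 0)"] by (simp add: eq)
  moreover from this have "D (1, 0) = 0"
    using assms vector_derivative_at by (fastforce simp: lie_bracket_def)
  ultimately show ?thesis by simp
qed

text \<open>Since \<open>Ad\<close> is multiplicative, the curve near \<open>s\<close> is a linear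
  map applied to the curve near \<open>0\<close>. The zero derivative at \<open>0\<close> thus
  propagates to every \<open>s\<close>, and the curve is constant.\<close>

lemma Ad_exp_eq:
  assumes "lie_bracket G \<kappa> ex \<xi> \<eta> = 0"
  shows "Ad G \<kappa> ex (ex (s *\<^sub>R \<xi>)) \<eta> = \<eta>"
proof -
  define \<gamma> where "\<gamma> = (\<lambda>s. Ad G \<kappa> ex (ex (s *\<^sub>R \<xi>)) \<eta>)"
  have "(\<gamma> has_derivative (\<lambda>h. 0)) (at s)" for s
  proof -
    have bl: "bounded_linear (Ad G \<kappa> ex (ex (s *\<^sub>R \<xi>)))"
      by (rule has_derivative_bounded_linear[OF Ad_has_derivative])
    have "((\<lambda>u. u - s) has_derivative (\<lambda>h. h)) (at s)" by (auto intro!: derivative_eq_intros)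
    moreover have "(\<gamma> has_derivative (\<lambda>h. 0)) (at (s - s))"
      using Ad_exp_has_derivative_zero[OF assms] by (simp add: \<gamma>_def has_vector_derivative_def)
    ultimately have "((\<lambda>u. \<gamma> (u - s)) has_derivative (\<lambda>h. 0)) (at s)"
      by (rule has_derivative_compose)
    then have "((\<lambda>u. Ad G \<kappa> ex (ex (s *\<^sub>R \<xi>)) (\<gamma> (u - s))) has_derivative (\<lambda>h. 0)) (at s)"
      using bounded_linear.has_derivative[OF bl] linear_simps(3)[OF bl] by fastforce
    moreover have "(\<lambda>u. Ad G \<kappa> ex (ex (s *\<^sub>R \<xi>)) (\<gamma> (u - s))) = \<gamma>"
    proof
      show "Ad G \<kappa> ex (ex (s *\<^sub>R \<xi>)) (\<gamma> (u - s)) = \<gamma> u" for u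
        using exp_scale_add[of s "u - s" \<xi>] by (simp add: \<gamma>_def Ad_mult[symmetric])
    qed
    ultimately show ?thesis by (simp only:)
  qed
  then obtain c where "\<And>s. \<gamma> s = c"
    using has_derivative_zero_constant[of UNIV \<gamma>] by auto
  then have "\<gamma> s = \<gamma> 0" by simp
  then show ?thesis by (simp add: \<gamma>_def exp_zero Ad_one)
qed

section \<open>Products of commuting exponentials\<close>

lemma exp_commute:
  assumes "lie_bracket G \<kappa> ex \<xi> \<eta> = 0"
  shows "ex (s *\<^sub>R \<xi>) \<otimes> ex (t *\<^sub>R \<eta>) = ex (t *\<^sub>R \<eta>) \<otimes> ex (s *\<^sub>R \<xi>)"
proof -
  have "ex (s *\<^sub>R \<xi>) \<otimes> ex (t *\<^sub>R \<eta>) \<otimes> inv (ex (s *\<^sub>R \<xi>)) = ex (t *\<^sub>R \<eta>)"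
    by (simp add: conj_exp Ad_exp_eq[OF assms])
  then have "ex (s *\<^sub>R \<xi>) \<otimes> ex (t *\<^sub>R \<eta>) \<otimes> inv (ex (s *\<^sub>R \<xi>)) \<otimes> ex (s *\<^sub>R \<xi>) = ex (t *\<^sub>R \<eta>) \<otimes> ex (s *\<^sub>R \<xi>)"
    by simp
  then show ?thesis by (simp add: m_assoc)
qed

text \<open>The product of two commuting one-parameter subgroups is again one. Its velocity is
  \<open>\<xi> + \<eta>\<close>, because the derivative of the two-variable map at
  \<open>(0, 0)\<close> is linear with values \<open>\<xi>\<close> and \<open>\<eta>\<close> on the
  axes. Uniqueness is used at parameter \<open>1\<close>.\<close>

lemma exp_add:
  assumes "lie_bracket G \<kappa> ex \<xi> \<eta> = 0"
  shows "ex (\<xi> + \<eta>) = ex \<xi> \<otimes> ex \<eta>"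
proof -
  let ?f = "\<lambda>z :: real \<times> real. ex (fst z *\<^sub>R \<xi>) \<otimes> ex (snd z *\<^sub>R \<eta>)"
  have "smooth_map euclidean_atlas \<A> ?f"
    by (intro smooth_map_mult smooth_map_exp bounded_linear_scaleR_const
        bounded_linear_fst bounded_linear_snd)
  then obtain D where D: "((\<lambda>z. \<kappa> (?f z)) has_derivative D) (at (0, 0))"
    using has_derivative_chart_one[of ?f "(0, 0)"] by (auto simp: exp_zero)
  note line = has_vector_derivative_along_line[OF D]
  have "D (1, 0) = \<xi>"
    using line[of "(1, 0)"] exp_derivative[of \<xi>] vector_derivative_unique_at by (fastforce simp: exp_zero)
  moreover have "D (0, 1) = \<eta>"
    using line[of "(0, 1)"] exp_derivative[of \<eta>] vector_derivative_unique_at by (fastforce simp: exp_zero)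
  ultimately have "D (1, 1) = \<xi> + \<eta>"
    using linear_add[OF has_derivative_linear[OF D], of "(1, 0)" "(0, 1)"] by simp
  then have der: "((\<lambda>t. \<kappa> (ex (t *\<^sub>R \<xi>) \<otimes> ex (t *\<^sub>R \<eta>))) has_vector_derivative \<xi> + \<eta>) (at 0)"
    using line[of "(1, 1)"] by simp
  have "ex (1 *\<^sub>R \<xi>) \<otimes> ex (1 *\<^sub>R \<eta>) = ex (1 *\<^sub>R (\<xi> + \<eta>))"
  proof (rule one_parameter_subgroup_unique[where c = "\<lambda>t. ex (t *\<^sub>R \<xi>) \<otimes> ex (t *\<^sub>R \<eta>)", OF _ _ der])
    fix s t :: real
    have "ex ((s + t) *\<^sub>R \<xi>) \<otimes> ex ((s + t) *\<^sub>R \<eta>)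
        = ex (s *\<^sub>R \<xi>) \<otimes> (ex (t *\<^sub>R \<xi>) \<otimes> ex (s *\<^sub>R \<eta>)) \<otimes> ex (t *\<^sub>R \<eta>)"
      by (simp add: exp_scale_add m_assoc)
    also have "\<dots> = ex (s *\<^sub>R \<xi>) \<otimes> ex (s *\<^sub>R \<eta>) \<otimes> (ex (t *\<^sub>R \<xi>) \<otimes> ex (t *\<^sub>R \<eta>))"
      by (subst exp_commute[OF assms]) (simp add: m_assoc)
    finally show "ex ((s + t) *\<^sub>R \<xi>) \<otimes> ex ((s + t) *\<^sub>R \<eta>)
        = ex (s *\<^sub>R \<xi>) \<otimes> ex (s *\<^sub>R \<eta>) \<otimes> (ex (t *\<^sub>R \<xi>) \<otimes> ex (t *\<^sub>R \<eta>))" .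
  next
    have "smooth_map euclidean_atlas \<A> (\<lambda>t. ex (t *\<^sub>R \<xi>) \<otimes> ex (t *\<^sub>R \<eta>))"
      by (intro smooth_map_mult smooth_map_exp bounded_linear_scaleR_left)
    then show "continuous_on UNIV (\<lambda>t. ex (t *\<^sub>R \<xi>) \<otimes> ex (t *\<^sub>R \<eta>))"
      by (simp add: smooth_map_def)
  qed
  then show ?thesis by simp
qed

end

section \<open>Convex potentials of abelian actions\<close>

text \<open>The image of the compact closure is compact, hence closed in the Hausdorff target, so it
  contains the closure of the image; continuity gives the reverse. This yields the first equality of
  the theorem.\<close>

lemma closure_image_of_compact_closure:
  fixes f :: "'a::topological_space \<Rightarrow> 'b::t2_space"
  assumes "compact (closure X)" "continuous_on UNIV f"
  shows "closure (f ` X) = f ` closure X"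
proof
  have cont: "continuous_on (closure X) f" using assms(2) continuous_on_subset by blast
  then have "closed (f ` closure X)"
    using assms(1) by (intro compact_imp_closed compact_continuous_image)
  then show "closure (f ` X) \<subseteq> f ` closure X"
    by (intro closure_minimal image_mono closure_subset)
  show "f ` closure X \<subseteq> closure (f ` X)"
    using cont by (intro image_closure_subset closure_subset closed_closure)
qed

text \<open>The situation freed from Lie groups: \<open>\<alpha> \<xi>\<close> stands for the action
  of \<open>ex \<xi>\<close>, \<open>\<psi> y \<xi>\<close> for \<open>\<Psi> y (ex \<xi>)\<close>,
  and \<open>\<Phi>\<close> for the gradient in the Euclidean inner product. Convexity enters as
  \<open>gradient_mono\<close>, its equality case as \<open>gradient_const\<close>, where constancy
  is asked on the half line \<open>0 \<le> t\<close>.\<close>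

locale gradient_action =
  fixes V :: "'e::euclidean_space set"
    and \<alpha> :: "'e \<Rightarrow> 'm::t2_space \<Rightarrow> 'm"
    and \<psi> :: "'m \<Rightarrow> 'e \<Rightarrow> real"
    and \<Phi> :: "'m \<Rightarrow> 'e"
  assumes subspace_V: "subspace V"
    and action_add: "\<lbrakk>\<xi> \<in> V; \<eta> \<in> V\<rbrakk> \<Longrightarrow> \<alpha> (\<xi> + \<eta>) y = \<alpha> \<xi> (\<alpha> \<eta> y)"
    and action_zero: "\<alpha> 0 y = y"
    and continuous_action: "\<xi> \<in> V \<Longrightarrow> continuous_on UNIV (\<alpha> \<xi>)"
    and cocycle: "\<lbrakk>\<xi> \<in> V; \<eta> \<in> V\<rbrakk> \<Longrightarrow> \<psi> y (\<xi> + \<eta>) = \<psi> y \<xi> + \<psi> (\<alpha> \<xi> y) \<eta>"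
    and continuous_potential: "continuous_on V (\<psi> y)"
    and gradient_mem: "\<Phi> y \<in> V"
    and gradient: "\<xi> \<in> V \<Longrightarrow> ((\<lambda>t. \<psi> y (t *\<^sub>R \<xi>)) has_real_derivative \<Phi> y \<bullet> \<xi>) (at 0)"
    and continuous_gradient: "continuous_on UNIV \<Phi>"
    and gradient_mono: "\<lbrakk>\<xi> \<in> V; 0 \<le> t\<rbrakk> \<Longrightarrow> \<Phi> y \<bullet> \<xi> \<le> \<Phi> (\<alpha> (t *\<^sub>R \<xi>) y) \<bullet> \<xi>"
    and gradient_const:
      "\<lbrakk>\<xi> \<in> V; \<And>t. 0 \<le> t \<Longrightarrow> \<Phi> (\<alpha> (t *\<^sub>R \<xi>) y) \<bullet> \<xi> = \<Phi> y \<bullet> \<xi>\<rbrakk> \<Longrightarrow> \<alpha> (s *\<^sub>R \<xi>) y = y"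
begin

section \<open>Tangent inequality and convexity of the closed gradient image\<close>

definition orb :: "'m \<Rightarrow> 'm set" where
  "orb x = (\<lambda>\<xi>. \<alpha> \<xi> x) ` V"

definition fixed :: "'m set" where
  "fixed = {y. \<forall>\<xi>\<in>V. \<alpha> \<xi> y = y}"

definition invariant :: "'m set \<Rightarrow> bool" where
  "invariant D \<longleftrightarrow> (\<forall>\<xi>\<in>V. \<forall>y\<in>D. \<alpha> \<xi> y \<in> D)"

text \<open>By the cocycle identity the potential along the line is a constant plus the potential of
  the moved point at \<open>(t - s) *\<^sub>R \<xi>\<close>; the derivative at \<open>s\<close> thus
  becomes one at \<open>0\<close>, where \<open>gradient\<close> applies.\<close>

lemma gradient_along:
  assumes "\<zeta> \<in> V" "\<xi> \<in> V"
  shows "((\<lambda>t. \<psi> y (\<zeta> + t *\<^sub>R \<xi>)) has_real_derivative \<Phi> (\<alpha> (\<zeta> + s *\<^sub>R \<xi>) y) \<bullet> \<xi>) (at s)"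
proof -
  let ?w = "\<zeta> + s *\<^sub>R \<xi>"
  have w: "?w \<in> V" using assms subspace_V by (simp add: subspace_add subspace_scale)
  have eq: "\<psi> y (\<zeta> + t *\<^sub>R \<xi>) = \<psi> y ?w + \<psi> (\<alpha> ?w y) ((t - s) *\<^sub>R \<xi>)" for t
    using cocycle[OF w, of "(t - s) *\<^sub>R \<xi>" y] subspace_scale[OF subspace_V assms(2), of "t - s"]
    by (simp add: algebra_simps)
  have "((\<lambda>t. \<psi> (\<alpha> ?w y) ((t - s) *\<^sub>R \<xi>)) has_real_derivative \<Phi> (\<alpha> ?w y) \<bullet> \<xi>) (at s)"
    using gradient[OF assms(2), of "\<alpha> ?w y"]
      DERIV_shift[of "\<lambda>t. \<psi> (\<alpha> ?w y) ((t - s) *\<^sub>R \<xi>)" "\<Phi> (\<alpha> ?w y) \<bullet> \<xi>" 0 s] by simp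
  then have "((\<lambda>t. \<psi> y ?w + \<psi> (\<alpha> ?w y) ((t - s) *\<^sub>R \<xi>)) has_real_derivative \<Phi> (\<alpha> ?w y) \<bullet> \<xi>) (at s)"
    by (auto intro!: derivative_eq_intros)
  then show ?thesis by (simp only: eq[abs_def, symmetric])
qed

text \<open>This is the tangent inequality of convexity: by the mean value theorem the increment is
  the slope at some \<open>z\<close> between \<open>0\<close> and \<open>1\<close>, and slopes
  increase by \<open>gradient_mono\<close>.\<close>

lemma subgradient:
  assumes "\<zeta> \<in> V" "\<eta> \<in> V"
  shows "\<psi> y \<zeta> + \<Phi> (\<alpha> \<zeta> y) \<bullet> \<eta> \<le> \<psi> y (\<zeta> + \<eta>)"
proof -
  obtain z :: real where z: "0 < z" "z < 1"
    and eq: "\<psi> y (\<zeta> + 1 *\<^sub>R \<eta>) - \<psi> y (\<zeta> + 0 *\<^sub>R \<eta>) = (1 - 0) * (\<Phi> (\<alpha> (\<zeta> + z *\<^sub>R \<eta>) y) \<bullet> \<eta>)"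
    using MVT2[of 0 1 "\<lambda>t. \<psi> y (\<zeta> + t *\<^sub>R \<eta>)" "\<lambda>s. \<Phi> (\<alpha> (\<zeta> + s *\<^sub>R \<eta>) y) \<bullet> \<eta>"]
      gradient_along[OF assms] by auto
  have "\<alpha> (\<zeta> + z *\<^sub>R \<eta>) y = \<alpha> (z *\<^sub>R \<eta>) (\<alpha> \<zeta> y)"
    using action_add[of "z *\<^sub>R \<eta>" \<zeta> y] assms subspace_V by (simp add: subspace_scale add.commute)
  then show ?thesis
    using eq gradient_mono[OF assms(2), of z "\<alpha> \<zeta> y"] z by simp
qed

text \<open>The vectors \<open>p\<close> whose tilted potential is bounded below form a convex set,
  and the tangent inequality puts every gradient along the orbit into it.\<close>

lemma bounded_below_of_hull:
  assumes "p \<in> convex hull (\<Phi> ` orb x)"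
  obtains c where "\<And>\<zeta>. \<zeta> \<in> V \<Longrightarrow> c \<le> \<psi> x \<zeta> - p \<bullet> \<zeta>"
proof -
  let ?Q = "{p. \<exists>c. \<forall>\<zeta>\<in>V. c \<le> \<psi> x \<zeta> - p \<bullet> \<zeta>}"
  have "convex ?Q"
  proof (rule convexI)
    fix p q :: 'e and u v :: real
    assume "p \<in> ?Q" "q \<in> ?Q" and uv: "0 \<le> u" "0 \<le> v" "u + v = 1"
    then obtain c d where "\<forall>\<zeta>\<in>V. c \<le> \<psi> x \<zeta> - p \<bullet> \<zeta>" "\<forall>\<zeta>\<in>V. d \<le> \<psi> x \<zeta> - q \<bullet> \<zeta>" by auto
    then have "u * c + v * d \<le> u * (\<psi> x \<zeta> - p \<bullet> \<zeta>) + v * (\<psi> x \<zeta> - q \<bullet> \<zeta>)" if "\<zeta> \<in> V" for \<zeta>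
      using uv that by (intro add_mono mult_left_mono) auto
    moreover have "u * (\<psi> x \<zeta> - p \<bullet> \<zeta>) + v * (\<psi> x \<zeta> - q \<bullet> \<zeta>) = \<psi> x \<zeta> - (u *\<^sub>R p + v *\<^sub>R q) \<bullet> \<zeta>" for \<zeta>
    proof -
      have "u * (\<psi> x \<zeta> - p \<bullet> \<zeta>) + v * (\<psi> x \<zeta> - q \<bullet> \<zeta>) = (u + v) * \<psi> x \<zeta> - (u *\<^sub>R p + v *\<^sub>R q) \<bullet> \<zeta>"
        by (simp add: algebra_simps)
      then show ?thesis using uv by simp
    qed
    ultimately show "u *\<^sub>R p + v *\<^sub>R q \<in> ?Q" by auto
  qed
  moreover have "\<Phi> ` orb x \<subseteq> ?Q"
  proof -
    have "\<Phi> (\<alpha> \<xi> x) \<in> ?Q" if "\<xi> \<in> V" for \<xi>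
    proof -
      have "\<psi> x \<xi> - \<Phi> (\<alpha> \<xi> x) \<bullet> \<xi> \<le> \<psi> x \<zeta> - \<Phi> (\<alpha> \<xi> x) \<bullet> \<zeta>" if "\<zeta> \<in> V" for \<zeta>
        using subgradient[OF \<open>\<xi> \<in> V\<close>, of "\<zeta> - \<xi>" x] \<open>\<xi> \<in> V\<close> that subspace_V
        by (simp add: subspace_diff inner_diff_right)
      then show ?thesis by auto
    qed
    then show ?thesis by (auto simp: orb_def)
  qed
  ultimately have "convex hull (\<Phi> ` orb x) \<subseteq> ?Q" by (simp add: hull_minimal)
  with assms that show thesis by blast
qed

text \<open>The added quadratic term makes the tilted potential coercive, so a minimiser exists; its
  critical point equation determines the gradient, and comparison with the value at \<open>0\<close>
  bounds its norm.\<close>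

lemma regularised_minimum:
  assumes bound: "\<And>\<zeta>. \<zeta> \<in> V \<Longrightarrow> c \<le> \<psi> x \<zeta> - p \<bullet> \<zeta>" and "p \<in> V" and "0 < \<epsilon>"
  obtains \<zeta> where "\<zeta> \<in> V" "\<Phi> (\<alpha> \<zeta> x) = p - \<epsilon> *\<^sub>R \<zeta>" "\<epsilon> * (\<zeta> \<bullet> \<zeta>) \<le> 2 * (\<psi> x 0 - c)"
proof -
  define h where "h \<zeta> = \<psi> x \<zeta> - p \<bullet> \<zeta> + \<epsilon> / 2 * (\<zeta> \<bullet> \<zeta>)" for \<zeta>
  have V0: "0 \<in> V" using subspace_V by (rule subspace_0)
  \<comment> \<open>Outside the ball of radius \<open>R\<close> the quadratic term exceeds
    \<open>\<psi> x 0 - c\<close>, so \<open>h\<close> is larger than \<open>h 0\<close> there; the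
    summand \<open>1\<close> makes this strict.\<close>
  define R where "R = sqrt (2 * (\<psi> x 0 - c) / \<epsilon>) + 1"
  have c0: "0 \<le> \<psi> x 0 - c" using bound[OF V0] by simp
  then have R: "2 * (\<psi> x 0 - c) / \<epsilon> < R\<^sup>2" "0 \<le> R"
  proof -
    have "0 \<le> 2 * (\<psi> x 0 - c) / \<epsilon>" using c0 \<open>0 < \<epsilon>\<close> by simp
    then show "2 * (\<psi> x 0 - c) / \<epsilon> < R\<^sup>2" "0 \<le> R"
      unfolding R_def by (auto simp: power2_sum add_pos_nonneg)
  qed
  have "continuous_on (V \<inter> cball 0 R) h"
    unfolding h_def by (intro continuous_intros continuous_on_subset[OF continuous_potential]) auto
  moreover have "compact (V \<inter> cball 0 R)"
    using closed_subspace[OF subspace_V] by (simp add: closed_Int_compact)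
  moreover have "V \<inter> cball 0 R \<noteq> {}" using V0 R by auto
  ultimately have "\<exists>\<zeta>\<in>V \<inter> cball 0 R. \<forall>w\<in>V \<inter> cball 0 R. h \<zeta> \<le> h w"
    by (intro continuous_attains_inf)
  then obtain \<zeta> where \<zeta>: "\<zeta> \<in> V" "\<And>w. w \<in> V \<inter> cball 0 R \<Longrightarrow> h \<zeta> \<le> h w"
    by blast
  have h0: "h \<zeta> \<le> h 0" using \<zeta>(2)[of 0] V0 R by simp
  have min: "h \<zeta> \<le> h w" if w: "w \<in> V" for w
  proof (cases "norm w \<le> R")
    case True
    then show ?thesis using \<zeta>(2) w by simp
  next
    case False
    then have "R\<^sup>2 \<le> w \<bullet> w"
      using R(2) by (simp add: power2_norm_eq_inner[symmetric] power_mono)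
    with R(1) have "2 * (\<psi> x 0 - c) / \<epsilon> < w \<bullet> w" by simp
    then have "\<psi> x 0 - c < \<epsilon> / 2 * (w \<bullet> w)"
      using \<open>0 < \<epsilon>\<close> by (simp add: field_simps)
    then have "h 0 < h w" using bound[OF w] by (simp add: h_def)
    with h0 show ?thesis by simp
  qed
  \<comment> \<open>The gradient of \<open>h\<close> at \<open>\<zeta>\<close>. The derivative of
    \<open>h\<close> in this very direction is its squared norm, which vanishes at a
    minimum.\<close>
  let ?r = "\<Phi> (\<alpha> \<zeta> x) - p + \<epsilon> *\<^sub>R \<zeta>"
  have r: "?r \<in> V"
    using gradient_mem \<open>p \<in> V\<close> \<zeta>(1) subspace_V by (simp add: subspace_add subspace_diff subspace_scale)
  have eq: "h (\<zeta> + t *\<^sub>R ?r) = \<psi> x (\<zeta> + t *\<^sub>R ?r) - (p \<bullet> \<zeta> + t * (p \<bullet> ?r))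
      + \<epsilon> / 2 * (\<zeta> \<bullet> \<zeta> + 2 * t * (\<zeta> \<bullet> ?r) + t\<^sup>2 * (?r \<bullet> ?r))" for t
    unfolding h_def
    by (simp add: inner_add_left inner_add_right inner_diff_left inner_diff_right inner_commute
        power2_eq_square algebra_simps)
  have "((\<lambda>t. h (\<zeta> + t *\<^sub>R ?r)) has_real_derivative (\<Phi> (\<alpha> \<zeta> x) \<bullet> ?r - p \<bullet> ?r + \<epsilon> * (\<zeta> \<bullet> ?r))) (at 0)"
    unfolding eq
    using gradient_along[OF \<zeta>(1) r, of x 0]
    by (auto intro!: derivative_eq_intros simp: algebra_simps)
  then have "\<Phi> (\<alpha> \<zeta> x) \<bullet> ?r - p \<bullet> ?r + \<epsilon> * (\<zeta> \<bullet> ?r) = 0"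
  proof (rule DERIV_local_min[of _ _ _ 1])
    show "\<forall>t. \<bar>0 - t\<bar> < 1 \<longrightarrow> h (\<zeta> + 0 *\<^sub>R ?r) \<le> h (\<zeta> + t *\<^sub>R ?r)"
      using min r \<zeta>(1) subspace_V by (simp add: subspace_add subspace_scale)
  qed simp
  then have "?r \<bullet> ?r = 0" by (simp add: inner_add_left inner_diff_left)
  then have "?r = 0" by simp
  then have "\<Phi> (\<alpha> \<zeta> x) = p - \<epsilon> *\<^sub>R \<zeta>" by (simp add: algebra_simps eq_neg_iff_add_eq_0)
  moreover have "\<epsilon> * (\<zeta> \<bullet> \<zeta>) \<le> 2 * (\<psi> x 0 - c)"
    using h0 bound[OF \<zeta>(1)] by (simp add: h_def)
  ultimately show thesis using that \<zeta>(1) by blast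
qed

lemma hull_subset_closure: "convex hull (\<Phi> ` orb x) \<subseteq> closure (\<Phi> ` orb x)"
proof
  fix p assume p: "p \<in> convex hull (\<Phi> ` orb x)"
  obtain c where c: "\<And>\<zeta>. \<zeta> \<in> V \<Longrightarrow> c \<le> \<psi> x \<zeta> - p \<bullet> \<zeta>"
    using bounded_below_of_hull[OF p] by blast
  have "convex hull (\<Phi> ` orb x) \<subseteq> V"
    by (rule hull_minimal) (use gradient_mem subspace_imp_convex[OF subspace_V] in auto)
  with p have pV: "p \<in> V" by blast
  have M: "0 \<le> \<psi> x 0 - c" using c[OF subspace_0[OF subspace_V]] by simp
  show "p \<in> closure (\<Phi> ` orb x)"
    unfolding closure_approachable
  proof (intro allI impI)
    fix \<delta> :: real assume "0 < \<delta>"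
    \<comment> \<open>The squared distance to \<open>p\<close> is
      \<open>\<epsilon> * (\<epsilon> * (\<zeta> \<bullet> \<zeta>))\<close>, at most
      \<open>\<epsilon> * (2 * (\<psi> x 0 - c))\<close>. With this \<open>\<epsilon>\<close> it is
      below \<open>\<delta>\<^sup>2\<close>, also when \<open>\<psi> x 0 = c\<close>.\<close>
    define \<epsilon> where "\<epsilon> = \<delta>\<^sup>2 / (2 * (\<psi> x 0 - c) + 1)"
    have \<epsilon>: "0 < \<epsilon>" using \<open>0 < \<delta>\<close> M by (simp add: \<epsilon>_def)
    obtain \<zeta> where \<zeta>: "\<zeta> \<in> V" "\<Phi> (\<alpha> \<zeta> x) = p - \<epsilon> *\<^sub>R \<zeta>" "\<epsilon> * (\<zeta> \<bullet> \<zeta>) \<le> 2 * (\<psi> x 0 - c)"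
      using regularised_minimum[OF c pV \<epsilon>] by blast
    have "(dist (\<Phi> (\<alpha> \<zeta> x)) p)\<^sup>2 = \<epsilon> * (\<epsilon> * (\<zeta> \<bullet> \<zeta>))"
      using \<epsilon> by (simp add: \<zeta>(2) dist_norm power_mult_distrib power2_norm_eq_inner[symmetric] power2_eq_square)
    also have "\<dots> \<le> \<epsilon> * (2 * (\<psi> x 0 - c))" using \<zeta>(3) \<epsilon> by simp
    also have "\<dots> < \<epsilon> * (2 * (\<psi> x 0 - c) + 1)" using \<epsilon> by simp
    also have "\<dots> = \<delta>\<^sup>2" using M by (simp add: \<epsilon>_def)
    finally have "dist (\<Phi> (\<alpha> \<zeta> x)) p < \<delta>" using \<open>0 < \<delta>\<close> power2_less_imp_less by fastforce
    then show "\<exists>q\<in>\<Phi> ` orb x. dist q p < \<delta>" using \<zeta>(1) by (auto simp: orb_def)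
  qed
qed

text \<open>The convex hull lies between the set and its closure, so both have the same closure, and
  closures of convex sets are convex.\<close>

lemma convex_closure_gradient_orbit: "convex (closure (\<Phi> ` orb x))"
proof -
  have "closure (\<Phi> ` orb x) = closure (convex hull (\<Phi> ` orb x))"
    using hull_subset_closure[of x] closure_mono[OF hull_subset[of "\<Phi> ` orb x" convex]]
      closure_minimal[of "convex hull (\<Phi> ` orb x)" "closure (\<Phi> ` orb x)"] by auto
  then show ?thesis by (simp add: convex_closure)
qed

lemma invariant_closure_orbit: "invariant (closure (orb x))"
  unfolding invariant_def
proof (intro ballI)
  fix \<xi> y assume \<xi>: "\<xi> \<in> V" and y: "y \<in> closure (orb x)"
  have "\<alpha> \<xi> ` orb x \<subseteq> orb x"
    using \<xi> subspace_V by (auto simp: orb_def action_add[symmetric] subspace_add)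
  then have "\<alpha> \<xi> ` closure (orb x) \<subseteq> closure (orb x)"
    using image_closure_subset[of "orb x" "\<alpha> \<xi>" "closure (orb x)"] continuous_action[OF \<xi>]
      closure_subset[of "orb x"] continuous_on_subset by blast
  with y show "\<alpha> \<xi> y \<in> closure (orb x)" by blast
qed

text \<open>The cocycle identity expands \<open>\<psi> y (\<eta> + t *\<^sub>R \<xi>)\<close> in two
  orders. As \<open>t *\<^sub>R \<xi>\<close> fixes \<open>y\<close>, the terms in
  \<open>\<eta>\<close> cancel, and the potentials of \<open>y\<close> and
  \<open>\<alpha> \<eta> y\<close> agree along \<open>\<xi>\<close>.\<close>

lemma gradient_invariant_direction:
  assumes "\<xi> \<in> V" "\<eta> \<in> V" and stab: "\<And>t. \<alpha> (t *\<^sub>R \<xi>) y = y"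
  shows "\<Phi> (\<alpha> \<eta> y) \<bullet> \<xi> = \<Phi> y \<bullet> \<xi>"
proof -
  have "\<psi> (\<alpha> \<eta> y) (t *\<^sub>R \<xi>) = \<psi> y (t *\<^sub>R \<xi>)" for t
    using cocycle[of \<eta> "t *\<^sub>R \<xi>" y] cocycle[of "t *\<^sub>R \<xi>" \<eta> y] assms subspace_V
    by (simp add: subspace_scale add.commute)
  then show ?thesis
    using gradient[OF assms(1), of y] gradient[OF assms(1), of "\<alpha> \<eta> y"] DERIV_unique by fastforce
qed

section \<open>Maximisers of linear functionals of the gradient\<close>

definition argmax :: "'m set \<Rightarrow> 'e \<Rightarrow> 'm set" where
  "argmax D \<xi> = {y \<in> D. \<forall>z\<in>D. \<Phi> z \<bullet> \<xi> \<le> \<Phi> y \<bullet> \<xi>}"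

text \<open>For \<open>0 \<le> t\<close> the component along \<open>\<xi>\<close> can only grow, but
  invariance of \<open>D\<close> keeps it at most the maximum; so it is constant and
  \<open>gradient_const\<close> applies.\<close>

lemma argmax_fixed:
  assumes "invariant D" "\<xi> \<in> V" "y \<in> argmax D \<xi>"
  shows "\<alpha> (s *\<^sub>R \<xi>) y = y"
proof (rule gradient_const[OF assms(2)])
  fix t :: real assume "0 \<le> t"
  moreover have "\<alpha> (t *\<^sub>R \<xi>) y \<in> D"
    using assms subspace_V by (simp add: invariant_def argmax_def subspace_scale)
  ultimately show "\<Phi> (\<alpha> (t *\<^sub>R \<xi>) y) \<bullet> \<xi> = \<Phi> y \<bullet> \<xi>"
    using gradient_mono[OF assms(2), of t y] assms(3) by (force simp: argmax_def)
qed

text \<open>The maximisers are a level set in \<open>D\<close>, hence compact. They are fixed by the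
  line through \<open>\<xi>\<close>, so the action does not change their component along
  \<open>\<xi>\<close>; this invariance lets the construction be iterated.\<close>

lemma argmax_props:
  assumes "compact D" "D \<noteq> {}" "invariant D" "\<xi> \<in> V"
  shows "compact (argmax D \<xi>)" "argmax D \<xi> \<noteq> {}" "invariant (argmax D \<xi>)"
proof -
  have cont: "continuous_on UNIV (\<lambda>y. \<Phi> y \<bullet> \<xi>)"
    by (intro continuous_intros continuous_gradient)
  obtain m where m: "m \<in> D" "\<And>z. z \<in> D \<Longrightarrow> \<Phi> z \<bullet> \<xi> \<le> \<Phi> m \<bullet> \<xi>"
    using continuous_attains_sup[OF assms(1,2) continuous_on_subset[OF cont]] by auto
  then show "argmax D \<xi> \<noteq> {}" by (auto simp: argmax_def)
  have "argmax D \<xi> = D \<inter> {y. \<Phi> y \<bullet> \<xi> = \<Phi> m \<bullet> \<xi>}"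
    using m by (auto simp: argmax_def intro: antisym)
  then show "compact (argmax D \<xi>)"
    using assms(1) closed_Collect_eq[OF cont continuous_on_const] by (simp add: compact_Int_closed)
  show "invariant (argmax D \<xi>)"
    unfolding invariant_def
  proof (intro ballI)
    fix \<eta> y assume \<eta>: "\<eta> \<in> V" and y: "y \<in> argmax D \<xi>"
    have "\<Phi> (\<alpha> \<eta> y) \<bullet> \<xi> = \<Phi> y \<bullet> \<xi>"
      by (rule gradient_invariant_direction[OF assms(4) \<eta> argmax_fixed[OF assms(3,4) y]])
    then show "\<alpha> \<eta> y \<in> argmax D \<xi>"
      using y \<eta> assms(3) by (simp add: argmax_def invariant_def)
  qed
qed

text \<open>Each new direction \<open>b\<close> replaces the current set by its maximisers along
  \<open>b\<close>. These are fixed by \<open>b\<close> and, being a subset, remain fixed by the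
  earlier directions.\<close>

lemma common_fixed_points:
  assumes "finite B" "B \<subseteq> V" "compact D" "D \<noteq> {}" "invariant D"
  shows "\<exists>D'\<subseteq>D. D' \<noteq> {} \<and> compact D' \<and> invariant D' \<and> (\<forall>b\<in>B. \<forall>t. \<forall>y\<in>D'. \<alpha> (t *\<^sub>R b) y = y)"
  using assms(1,2)
proof (induction B rule: finite_induct)
  case empty
  then show ?case using assms by blast
next
  case (insert b B)
  then obtain D' where D': "D' \<subseteq> D" "D' \<noteq> {}" "compact D'" "invariant D'"
    "\<forall>b\<in>B. \<forall>t. \<forall>y\<in>D'. \<alpha> (t *\<^sub>R b) y = y" by auto
  have b: "b \<in> V" using insert.prems by simp
  have "argmax D' b \<subseteq> D'" by (auto simp: argmax_def)
  then show ?case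
    using D' argmax_props[OF D'(3,2,4) b] argmax_fixed[OF D'(4) b]
    by (intro exI[of _ "argmax D' b"]) auto
qed

text \<open>Passing first to the maximisers along \<open>\<xi>\<close> and only then to common fixed
  points for a basis preserves maximality.\<close>

lemma fixed_point_maximising:
  assumes "compact D" "D \<noteq> {}" "invariant D" "\<xi> \<in> V"
  obtains y where "y \<in> D \<inter> fixed" "\<And>z. z \<in> D \<Longrightarrow> \<Phi> z \<bullet> \<xi> \<le> \<Phi> y \<bullet> \<xi>"
proof -
  obtain B where B: "B \<subseteq> V" "finite B" "V = span B"
    using basis_exists[of V] span_subspace[OF _ _ subspace_V] finiteI_independent by metis
  obtain D' y where D': "D' \<subseteq> argmax D \<xi>" "y \<in> D'" "\<forall>b\<in>B. \<forall>t. \<forall>y\<in>D'. \<alpha> (t *\<^sub>R b) y = y"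
    using common_fixed_points[OF B(2,1) argmax_props[OF assms]] by blast
  \<comment> \<open>Quantifying over all \<open>t\<close> makes the vectors whose line fixes
    \<open>y\<close> a subspace; it contains the spanning set \<open>B\<close>, hence
    \<open>V\<close>.\<close>
  let ?W = "{\<eta> \<in> V. \<forall>t. \<alpha> (t *\<^sub>R \<eta>) y = y}"
  have "subspace ?W"
    using subspace_V
    by (auto simp: subspace_def action_zero scaleR_add_right action_add)
  moreover have "B \<subseteq> ?W" using B(1) D' by auto
  ultimately have "V \<subseteq> ?W" unfolding B(3) by (rule span_minimal[rotated])
  then have "\<alpha> \<eta> y = y" if "\<eta> \<in> V" for \<eta>
    using that by (auto dest!: subsetD spec[of _ 1])
  then show thesis
    using that[of y] D' by (auto simp: fixed_def argmax_def)
qed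

theorem gradient_closure_orbit:
  assumes "compact (closure (orb x))"
  shows "\<Phi> ` closure (orb x) = convex hull (\<Phi> ` (closure (orb x) \<inter> fixed))"
proof -
  let ?C = "closure (orb x)"
  have "orb x \<noteq> {}" using subspace_0[OF subspace_V] by (auto simp: orb_def)
  then have ne: "?C \<noteq> {}" by simp
  have "closed fixed"
  proof -
    have "fixed = (\<Inter>\<xi>\<in>V. {y. \<alpha> \<xi> y = y})" by (auto simp: fixed_def)
    then show ?thesis
      by (simp add: closed_INT closed_Collect_eq continuous_action)
  qed
  then have "compact (\<Phi> ` (?C \<inter> fixed))"
    using assms continuous_on_subset[OF continuous_gradient]
    by (intro compact_continuous_image compact_Int_closed) auto
  then have cl: "closed (convex hull (\<Phi> ` (?C \<inter> fixed)))"
    by (intro compact_imp_closed compact_convex_hull)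
  have imC: "\<Phi> ` ?C = closure (\<Phi> ` orb x)"
    using closure_image_of_compact_closure[OF assms continuous_gradient] by simp
  show ?thesis
  proof
    show "convex hull (\<Phi> ` (?C \<inter> fixed)) \<subseteq> \<Phi> ` ?C"
      using convex_closure_gradient_orbit[of x] by (intro hull_minimal) (auto simp: imC[symmetric])
    show "\<Phi> ` ?C \<subseteq> convex hull (\<Phi> ` (?C \<inter> fixed))"
    proof (rule ccontr)
      assume "\<not> ?thesis"
      then obtain z where z: "z \<in> ?C" "\<Phi> z \<notin> convex hull (\<Phi> ` (?C \<inter> fixed))" by auto
      obtain a b where ab: "a \<bullet> \<Phi> z < b" "\<And>q. q \<in> convex hull (\<Phi> ` (?C \<inter> fixed)) \<Longrightarrow> b < a \<bullet> q"
        using separating_hyperplane_closed_point[OF convex_convex_hull cl z(2)] by blast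
      \<comment> \<open>The normal \<open>a\<close> need not lie in \<open>V\<close>. The component
        \<open>v\<close> of \<open>- a\<close> in \<open>V\<close> gives the same functional on
        gradients as \<open>- a\<close>; the sign turns separation from below into
        maximisation.\<close>
      obtain v w where vw: "v \<in> V" "\<And>u. u \<in> V \<Longrightarrow> orthogonal w u" "- a = v + w"
        using orthogonal_subspace_decomp_exists[of V "- a"] subspace_V span_eq_iff by metis
      have va: "u \<bullet> v = - (a \<bullet> u)" if "u \<in> V" for u
      proof -
        have "v = - a - w" using vw(3) by (simp add: algebra_simps)
        then show ?thesis
          using vw(2)[OF that] by (simp add: orthogonal_def inner_diff_right inner_commute)
      qed
      obtain y where y: "y \<in> ?C \<inter> fixed" "\<And>u. u \<in> ?C \<Longrightarrow> \<Phi> u \<bullet> v \<le> \<Phi> y \<bullet> v"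
        using fixed_point_maximising[OF assms ne invariant_closure_orbit vw(1)] by blast
      have "b < a \<bullet> \<Phi> y" using y(1) by (intro ab(2) hull_inc) auto
      then show False using ab(1) y(2)[OF z(1)] by (simp add: va gradient_mem)
    qed
  qed
qed

end

section \<open>Scalar products on subspaces\<close>

text \<open>Projections are chosen pointwise; they are linear because a vector of \<open>V\<close>
  is determined by its inner products with \<open>V\<close>.\<close>

lemma orthogonal_projection_exists:
  fixes V :: "'e::euclidean_space set"
  assumes "subspace V"
  obtains P :: "'e \<Rightarrow> 'e" where "linear P" "range P \<subseteq> V" "\<And>v. v \<in> V \<Longrightarrow> P v = v"
    "\<And>u v. v \<in> V \<Longrightarrow> P u \<bullet> v = u \<bullet> v"
proof -
  have "\<exists>p. \<forall>u. p u \<in> V \<and> (\<forall>v\<in>V. p u \<bullet> v = u \<bullet> v)"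
  proof (rule choice, rule allI)
    fix u :: 'e
    obtain y z where "y \<in> V" "\<And>w. w \<in> V \<Longrightarrow> orthogonal z w" "u = y + z"
      using orthogonal_subspace_decomp_exists[of V u] assms span_eq_iff by metis
    then show "\<exists>p. p \<in> V \<and> (\<forall>v\<in>V. p \<bullet> v = u \<bullet> v)"
      by (intro exI[of _ y]) (simp add: inner_add_left orthogonal_def)
  qed
  then obtain P where P: "\<And>u. P u \<in> V" "\<And>u v. v \<in> V \<Longrightarrow> P u \<bullet> v = u \<bullet> v" by blast
  have uniq: "p = q" if "p \<in> V" "q \<in> V" "\<And>v. v \<in> V \<Longrightarrow> p \<bullet> v = q \<bullet> v" for p q
  proof -
    have "(p - q) \<bullet> (p - q) = 0"
      using that(3)[of "p - q"] that(1,2) assms by (simp add: subspace_diff inner_diff_left)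
    then show ?thesis by simp
  qed
  have "linear P"
  proof (rule linearI)
    show "P (u + w) = P u + P w" for u w
      by (rule uniq) (use P assms in \<open>auto simp: subspace_add inner_add_left\<close>)
    show "P (r *\<^sub>R u) = r *\<^sub>R P u" for r u
      by (rule uniq) (use P assms in \<open>auto simp: subspace_scale\<close>)
  qed
  moreover have "P v = v" if "v \<in> V" for v
    by (rule uniq) (use P that in auto)
  ultimately show thesis using that P by blast
qed

section \<open>Scalar products given on a subspace, and their gradients\<close>

lemma scalar_product_onD:
  assumes "scalar_product_on V ip"
  shows "\<And>\<xi> \<eta> \<zeta>. \<xi> \<in> V \<Longrightarrow> \<eta> \<in> V \<Longrightarrow> \<zeta> \<in> V \<Longrightarrow> ip (\<xi> + \<eta>) \<zeta> = ip \<xi> \<zeta> + ip \<eta> \<zeta>"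
    and "\<And>c \<xi> \<eta>. \<xi> \<in> V \<Longrightarrow> \<eta> \<in> V \<Longrightarrow> ip (c *\<^sub>R \<xi>) \<eta> = c * ip \<xi> \<eta>"
    and "\<And>\<xi> \<eta>. \<xi> \<in> V \<Longrightarrow> \<eta> \<in> V \<Longrightarrow> ip \<xi> \<eta> = ip \<eta> \<xi>"
    and "\<And>\<xi>. \<xi> \<in> V \<Longrightarrow> ip \<xi> \<xi> = 0 \<Longrightarrow> \<xi> = 0"
proof -
  note D = assms[unfolded scalar_product_on_def]
  show "ip (\<xi> + \<eta>) \<zeta> = ip \<xi> \<zeta> + ip \<eta> \<zeta>" if "\<xi> \<in> V" "\<eta> \<in> V" "\<zeta> \<in> V" for \<xi> \<eta> \<zeta>
    using conjunct1[OF D] that by simp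
  show "ip (c *\<^sub>R \<xi>) \<eta> = c * ip \<xi> \<eta>" if "\<xi> \<in> V" "\<eta> \<in> V" for c \<xi> \<eta>
    using conjunct1[OF conjunct2[OF D]] that by simp
  show "ip \<xi> \<eta> = ip \<eta> \<xi>" if "\<xi> \<in> V" "\<eta> \<in> V" for \<xi> \<eta>
    by (rule bspec[OF bspec[OF conjunct1[OF conjunct2[OF conjunct2[OF D]]] that(1)] that(2)])
  show "\<xi> = 0" if "\<xi> \<in> V" "ip \<xi> \<xi> = 0" for \<xi>
    using conjunct2[OF conjunct2[OF conjunct2[OF D]]] that by fastforce
qed

lemma scalar_product_sum_left:
  assumes "subspace V" "scalar_product_on V ip" "\<zeta> \<in> V" "\<And>i. i \<in> I \<Longrightarrow> v i \<in> V"
  shows "ip (\<Sum>i\<in>I. c i *\<^sub>R v i) \<zeta> = (\<Sum>i\<in>I. c i * ip (v i) \<zeta>)"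
  using assms(4)
proof (induction I rule: infinite_finite_induct)
  case (insert i I)
  then have "c i *\<^sub>R v i \<in> V" "(\<Sum>i\<in>I. c i *\<^sub>R v i) \<in> V"
    using assms(1) by (auto intro: subspace_scale subspace_sum)
  then have "ip (c i *\<^sub>R v i + (\<Sum>i\<in>I. c i *\<^sub>R v i)) \<zeta> = ip (c i *\<^sub>R v i) \<zeta> + ip (\<Sum>i\<in>I. c i *\<^sub>R v i) \<zeta>"
    using scalar_product_onD(1)[OF assms(2) _ _ assms(3)] by simp
  moreover have "ip (c i *\<^sub>R v i) \<zeta> = c i * ip (v i) \<zeta>"
    using scalar_product_onD(2)[OF assms(2) _ assms(3)] insert.prems by simp
  ultimately show ?case using insert by simp
next
  case empty
  \<comment> \<open>The value \<open>ip 0 \<zeta> = 0\<close> is obtained by scaling with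
    \<open>0\<close>. It also settles infinite \<open>I\<close>, where sums are \<open>0\<close> by
    convention.\<close>
  have "ip (0 *\<^sub>R \<zeta>) \<zeta> = 0 * ip \<zeta> \<zeta>" by (rule scalar_product_onD(2)[OF assms(2,3,3)])
  then show ?case by simp
next
  case (infinite I)
  have "ip (0 *\<^sub>R \<zeta>) \<zeta> = 0 * ip \<zeta> \<zeta>" by (rule scalar_product_onD(2)[OF assms(2,3,3)])
  with infinite show ?case by simp
qed

text \<open>\<open>S\<close> is the Gram operator of \<open>ip\<close> relative to the Euclidean
  inner product and converts gradients for \<open>ip\<close> into Euclidean ones. Positivity makes
  it injective on \<open>V\<close>, and equality of dimensions makes it onto.\<close>

lemma scalar_product_operator:
  fixes V :: "'e::euclidean_space set"
  assumes V: "subspace V" and ip: "scalar_product_on V ip"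
  obtains S :: "'e \<Rightarrow> 'e" where "linear S" "inj_on S V" "S ` V = V"
    "\<And>\<zeta> \<xi>. \<zeta> \<in> V \<Longrightarrow> \<xi> \<in> V \<Longrightarrow> S \<zeta> \<bullet> \<xi> = ip \<zeta> \<xi>"
proof -
  obtain P :: "'e \<Rightarrow> 'e" where P: "linear P" "range P \<subseteq> V" "\<And>v. v \<in> V \<Longrightarrow> P v = v"
      "\<And>u v. v \<in> V \<Longrightarrow> P u \<bullet> v = u \<bullet> v"
    using orthogonal_projection_exists[OF V] by blast
  have PV: "P u \<in> V" for u using P(2) by blast
  have rep: "ip \<zeta> \<xi> = (\<Sum>i\<in>Basis. (\<zeta> \<bullet> i) * ip (P i) \<xi>)" if "\<zeta> \<in> V" "\<xi> \<in> V" for \<zeta> \<xi>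
  proof -
    have "\<zeta> = P (\<Sum>i\<in>Basis. (\<zeta> \<bullet> i) *\<^sub>R i)" using P(3)[OF that(1)] by (simp add: euclidean_representation)
    also have "\<dots> = (\<Sum>i\<in>Basis. (\<zeta> \<bullet> i) *\<^sub>R P i)" by (simp add: linear_sum[OF P(1)] linear_cmul[OF P(1)])
    finally have "ip \<zeta> \<xi> = ip (\<Sum>i\<in>Basis. (\<zeta> \<bullet> i) *\<^sub>R P i) \<xi>" by simp
    then show ?thesis using scalar_product_sum_left[OF V ip that(2), of Basis P] PV by simp
  qed
  \<comment> \<open>Since \<open>ip\<close> is only controlled on \<open>V\<close>, the matrix uses
    the projected basis vectors \<open>P i\<close>, and the outer \<open>P\<close> returns the
    result to \<open>V\<close>.\<close>
  define S where "S \<zeta> = P (\<Sum>j\<in>Basis. (\<Sum>i\<in>Basis. (\<zeta> \<bullet> i) * ip (P i) (P j)) *\<^sub>R j)" for \<zeta>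
  have "linear (\<lambda>\<zeta>. \<Sum>j\<in>Basis. (\<Sum>i\<in>Basis. (\<zeta> \<bullet> i) * ip (P i) (P j)) *\<^sub>R j)"
    by (rule linearI)
      (simp_all add: inner_add_left distrib_right sum.distrib scaleR_add_left scaleR_sum_right
        sum_distrib_left mult.assoc)
  then have linS: "linear S" unfolding S_def using linear_compose[OF _ P(1)] by (simp add: o_def)
  note sym = scalar_product_onD(3)[OF ip]
  have S: "S \<zeta> \<bullet> \<xi> = ip \<zeta> \<xi>" if "\<zeta> \<in> V" "\<xi> \<in> V" for \<zeta> \<xi>
  proof -
    have "S \<zeta> \<bullet> \<xi> = (\<Sum>j\<in>Basis. ip \<zeta> (P j) * (j \<bullet> \<xi>))"
      unfolding S_def P(4)[OF that(2)] by (simp add: inner_sum_left rep[OF that(1) PV])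
    also have "\<dots> = (\<Sum>j\<in>Basis. (\<xi> \<bullet> j) * ip (P j) \<zeta>)"
      by (simp add: sym[OF that(1) PV] inner_commute[of \<xi>] mult.commute)
    finally show ?thesis using rep[OF that(2,1)] sym[OF that] by simp
  qed
  have inj: "inj_on S V"
  proof (rule inj_onI)
    fix u w assume uw: "u \<in> V" "w \<in> V" "S u = S w"
    have d: "u - w \<in> V" using uw V by (simp add: subspace_diff)
    have "S (u - w) = 0" using uw(3) by (simp add: linear_diff[OF linS])
    then have "ip (u - w) (u - w) = 0" using S[OF d d] by simp
    then show "u = w" using scalar_product_onD(4)[OF ip d] by simp
  qed
  have "S ` V \<subseteq> V" using PV by (auto simp: S_def)
  moreover have "dim (S ` V) = dim V"
    using dim_image_eq[OF linS] inj span_eq_iff[THEN iffD2, OF V] by metis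
  ultimately have "S ` V = V"
    using subspace_dim_equal[of "S ` V" V] linear_subspace_image[OF linS V] V by simp
  then show thesis using that linS inj S by blast
qed

text \<open>\<open>gradient_map\<close> is a definite description, so unique existence is needed.
  Existence is Riesz representation in three moves: a Euclidean vector \<open>a\<close> for
  \<open>D\<close>, its projection to \<open>V\<close>, and the preimage under \<open>S\<close>.
  Uniqueness is positivity of \<open>ip\<close>.\<close>

lemma gradient_map_works:
  assumes V: "subspace V" and ip: "scalar_product_on V ip"
    and D: "linear D" "\<And>\<xi>. \<xi> \<in> V \<Longrightarrow> deriv (\<lambda>t. \<Psi> x (ex (t *\<^sub>R \<xi>))) 0 = D \<xi>"
  shows "gradient_map ex V ip \<Psi> x \<in> V"
    and "\<xi> \<in> V \<Longrightarrow> ip (gradient_map ex V ip \<Psi> x) \<xi> = D \<xi>"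
proof -
  let ?Q = "\<lambda>\<zeta>. \<zeta> \<in> V \<and> (\<forall>\<xi>\<in>V. ip \<zeta> \<xi> = deriv (\<lambda>t. \<Psi> x (ex (t *\<^sub>R \<xi>))) 0)"
  obtain S where S: "linear S" "inj_on S V" "S ` V = V"
      "\<And>\<zeta> \<xi>. \<zeta> \<in> V \<Longrightarrow> \<xi> \<in> V \<Longrightarrow> S \<zeta> \<bullet> \<xi> = ip \<zeta> \<xi>"
    using scalar_product_operator[OF V ip] by blast
  obtain P where P: "range P \<subseteq> V" "\<And>u v. v \<in> V \<Longrightarrow> P u \<bullet> v = u \<bullet> v"
    using orthogonal_projection_exists[OF V] by metis
  define a where "a = (\<Sum>i\<in>Basis. D i *\<^sub>R i)"
  have a: "a \<bullet> \<xi> = D \<xi>" for \<xi>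
  proof -
    have "D \<xi> = D (\<Sum>i\<in>Basis. (\<xi> \<bullet> i) *\<^sub>R i)" by (simp add: euclidean_representation)
    also have "\<dots> = (\<Sum>i\<in>Basis. (\<xi> \<bullet> i) * D i)"
      by (simp add: linear_sum[OF D(1)] linear_cmul[OF D(1)])
    finally show ?thesis by (simp add: a_def inner_sum_left inner_commute[of \<xi>] mult.commute)
  qed
  have "P a \<in> S ` V" using P(1) S(3) by auto
  then obtain \<zeta> where \<zeta>: "\<zeta> \<in> V" "S \<zeta> = P a" by auto
  have "\<exists>!\<zeta>. ?Q \<zeta>"
  proof (rule ex1I)
    show Q: "?Q \<zeta>" using \<zeta> S(4)[OF \<zeta>(1)] P(2) a D(2) by auto
    fix w assume w: "?Q w"
    have d: "\<zeta> - w \<in> V" using Q w V by (simp add: subspace_diff)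
    have "S \<zeta> \<bullet> (\<zeta> - w) = S w \<bullet> (\<zeta> - w)"
      using S(4) Q w d by simp
    then have "S (\<zeta> - w) \<bullet> (\<zeta> - w) = 0" by (simp add: linear_diff[OF S(1)] inner_diff_left)
    then have "ip (\<zeta> - w) (\<zeta> - w) = 0" using S(4)[OF d d] by simp
    then show "w = \<zeta>" using scalar_product_onD(4)[OF ip d] by simp
  qed
  then have "?Q (gradient_map ex V ip \<Psi> x)" unfolding gradient_map_def by (rule theI')
  then show "gradient_map ex V ip \<Psi> x \<in> V"
    and "\<xi> \<in> V \<Longrightarrow> ip (gradient_map ex V ip \<Psi> x) \<xi> = D \<xi>"
    using D(2) by auto
qed

section \<open>The gradient map on orbit closures\<close>

theorem theorem2p1:
  fixes G :: "('g::{t2_space, second_countable_topology}) monoid"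
    and \<A> :: "('g, 'e::euclidean_space) chart set"
    and \<kappa> :: "'g \<Rightarrow> 'e"
    and ex :: "'e \<Rightarrow> 'g"
    and K :: "'g set"
    and \<pp> \<aa> :: "'e set"
    and ip :: "'e \<Rightarrow> 'e \<Rightarrow> real"
    and act :: "'g \<Rightarrow> 'm::t2_space \<Rightarrow> 'm"
    and \<Psi> :: "'m \<Rightarrow> 'g \<Rightarrow> real"
    and x :: 'm
  defines "A \<equiv> ex ` \<aa>"
    and "\<FF> \<equiv> gradient_map ex \<aa> ip \<Psi>"
  defines "Ax \<equiv> orbit (G\<lparr>carrier := A\<rparr>) act x"
  assumes "real_reductive_group G \<A> \<kappa> ex K \<pp>"
    and "scalar_product_on \<pp> ip" and "Ad_invariant_on G \<kappa> ex K \<pp> ip"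
    and "abelian_subalgebra (lie_bracket G \<kappa> ex) \<aa>" and "\<aa> \<subseteq> \<pp>"
    and "continuous_action G act"
    and "kempf_ness G act ex \<aa> ip \<Psi>"
    and "compact (closure Ax)"
  shows "closure (\<FF> ` Ax) = \<FF> ` closure Ax \<and>
         \<FF> ` closure Ax = convex hull (\<FF> ` (closure Ax \<inter> fixed_points A act))"
proof -
  interpret real_reductive_group G \<A> \<kappa> ex K \<pp> by fact
  have V: "subspace \<aa>" and bracket: "\<And>\<xi> \<eta>. \<xi> \<in> \<aa> \<Longrightarrow> \<eta> \<in> \<aa> \<Longrightarrow> lie_bracket G \<kappa> ex \<xi> \<eta> = 0"
    using \<open>abelian_subalgebra _ \<aa>\<close> by (auto simp: abelian_subalgebra_def)
  have ip: "scalar_product_on \<aa> ip"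
    using \<open>scalar_product_on \<pp> ip\<close> \<open>\<aa> \<subseteq> \<pp>\<close> unfolding scalar_product_on_def by (meson subsetD)
  have "group_action G UNIV act" and act_cont: "continuous_on UNIV (\<lambda>(g, y). act g y)"
    using \<open>continuous_action G act\<close> by (auto simp: continuous_action_def)
  then interpret act: group_action G UNIV act by simp
  have act_mult: "act (g \<otimes>\<^bsub>G\<^esub> h) y = act g (act h y)" for g h y
    by (rule act.composition_rule) auto
  have act_one: "act \<one>\<^bsub>G\<^esub> y = y" for y
    using fun_cong[OF act.id_eq_one, of y] by simp
  note KN = \<open>kempf_ness G act ex \<aa> ip \<Psi>\<close>[unfolded kempf_ness_def]
  note KN1 = conjunct1[OF KN] and KN2 = conjunct1[OF conjunct2[OF KN]]
    and KN3 = conjunct1[OF conjunct2[OF conjunct2[OF KN]]]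
    and KN4 = conjunct2[OF conjunct2[OF conjunct2[OF KN]]]
  have KN_smooth: "smooth_on UNIV (\<lambda>\<zeta>. \<Psi> y (ex (L \<zeta>)))" if "linear L" "range L \<subseteq> \<aa>" for y and L :: "'e \<Rightarrow> 'e"
    using KN1 that by simp
  have KN_convex: "0 \<le> (deriv ^^ 2) (\<lambda>s. \<Psi> y (ex (s *\<^sub>R \<xi>))) t" if "\<xi> \<in> \<aa>" for y \<xi> t
    using KN2 that by blast
  have KN_stab: "range (\<lambda>t. ex (t *\<^sub>R \<xi>)) \<subseteq> stabilizer (G\<lparr>carrier := ex ` \<aa>\<rparr>) act y"
    if "\<xi> \<in> \<aa>" "(deriv ^^ 2) (\<lambda>s. \<Psi> y (ex (s *\<^sub>R \<xi>))) 0 = 0" for y \<xi>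
    using KN2 that by blast
  have KN_cocycle: "\<Psi> y g + \<Psi> (act g y) h = \<Psi> y (h \<otimes>\<^bsub>G\<^esub> g)" if "g \<in> ex ` \<aa>" "h \<in> ex ` \<aa>" for y g h
    using KN3 that by blast
  have \<FF>_cont: "continuous_on UNIV \<FF>"
    using KN4 by (simp add: \<FF>_def)
  \<comment> \<open>\<open>P\<close> serves as the linear map in the smoothness condition; composing
    with it changes nothing on \<open>\<aa>\<close>.\<close>
  obtain P :: "'e \<Rightarrow> 'e" where P: "linear P" "range P \<subseteq> \<aa>" "\<And>v. v \<in> \<aa> \<Longrightarrow> P v = v"
    using orthogonal_projection_exists[OF V] by metis
  obtain S :: "'e \<Rightarrow> 'e" where S: "linear S" "inj_on S \<aa>" "S ` \<aa> = \<aa>"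
      "\<And>\<zeta> \<xi>. \<zeta> \<in> \<aa> \<Longrightarrow> \<xi> \<in> \<aa> \<Longrightarrow> S \<zeta> \<bullet> \<xi> = ip \<zeta> \<xi>"
    using scalar_product_operator[OF V ip] by blast
  define \<phi> where "\<phi> = (\<lambda>y \<xi> t. \<Psi> y (ex (t *\<^sub>R \<xi>)))"
  have sm: "smooth_on UNIV (\<phi> y \<xi>)" if "\<xi> \<in> \<aa>" for y \<xi>
  proof -
    have "smooth_on UNIV (\<lambda>t::real. \<Psi> y (ex (P (t *\<^sub>R \<xi>))))"
      by (rule smooth_on_compose[OF open_UNIV smooth_on_bounded_linear[OF open_UNIV bounded_linear_scaleR_left]
            KN_smooth[OF P(1,2)]]) simp
    then show ?thesis using that V by (simp add: \<phi>_def P(3) subspace_scale)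
  qed
  have \<FF>: "\<FF> y \<in> \<aa>" "\<xi> \<in> \<aa> \<Longrightarrow> ip (\<FF> y) \<xi> = deriv (\<phi> y \<xi>) 0" for y \<xi>
  proof -
    \<comment> \<open>Smoothness makes the derivative at \<open>0\<close> linear in the direction,
      which ensures that the gradient exists.\<close>
    let ?D = "frechet_derivative (\<lambda>\<zeta>. \<Psi> y (ex (P \<zeta>))) (at 0)"
    have D: "((\<lambda>\<zeta>. \<Psi> y (ex (P \<zeta>))) has_derivative ?D) (at 0)"
      by (rule smooth_on_imp_has_derivative[OF KN_smooth[OF P(1,2)]]) simp
    have eq: "deriv (\<lambda>t. \<Psi> y (ex (t *\<^sub>R \<xi>))) 0 = ?D \<xi>" if "\<xi> \<in> \<aa>" for \<xi>
      using has_vector_derivative_along_line[OF D, of \<xi>] that V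
      by (auto intro!: DERIV_imp_deriv
          simp: P(3) subspace_scale has_real_derivative_iff_has_vector_derivative)
    note gradient_map_works[OF V ip has_derivative_linear[OF D], of \<Psi> y ex, OF eq]
    then show "\<FF> y \<in> \<aa>" "\<xi> \<in> \<aa> \<Longrightarrow> ip (\<FF> y) \<xi> = deriv (\<phi> y \<xi>) 0"
      by (simp_all add: \<FF>_def \<phi>_def eq)
  qed
  have ex_add: "ex (\<xi> + \<eta>) = ex \<xi> \<otimes>\<^bsub>G\<^esub> ex \<eta>" if "\<xi> \<in> \<aa>" "\<eta> \<in> \<aa>" for \<xi> \<eta>
    using exp_add bracket that by blast
  \<comment> \<open>The cocycle condition has the order \<open>h \<otimes> g\<close>; commutativity
    of addition in \<open>\<aa>\<close> reconciles it with \<open>\<xi> + \<eta>\<close>.\<close>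
  have cocycle: "\<Psi> y (ex (\<xi> + \<eta>)) = \<Psi> y (ex \<xi>) + \<Psi> (act (ex \<xi>) y) (ex \<eta>)"
    if "\<xi> \<in> \<aa>" "\<eta> \<in> \<aa>" for y \<xi> \<eta>
    using KN_cocycle[of "ex \<xi>" "ex \<eta>" y] ex_add[OF that(2,1)] that by (simp add: add.commute)
  \<comment> \<open>Moving the base point by \<open>ex (t *\<^sub>R \<xi>)\<close> shifts the
    potential along the line by \<open>t\<close>, up to a constant, so the gradient component at the
    moved point is the slope at \<open>t\<close>.\<close>
  have \<FF>_along: "ip (\<FF> (act (ex (t *\<^sub>R \<xi>)) y)) \<xi> = deriv (\<phi> y \<xi>) t" if \<xi>: "\<xi> \<in> \<aa>" for y \<xi> t
  proof -
    have "\<phi> (act (ex (t *\<^sub>R \<xi>)) y) \<xi> = (\<lambda>s. \<phi> y \<xi> (s + t) - \<phi> y \<xi> t)"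
      using cocycle[of "t *\<^sub>R \<xi>" "s *\<^sub>R \<xi>" y for s] \<xi> V
      by (auto simp: \<phi>_def subspace_scale scaleR_add_left add.commute)
    moreover have "((\<lambda>s. \<phi> y \<xi> (s + t) - \<phi> y \<xi> t) has_real_derivative deriv (\<phi> y \<xi>) t) (at 0)"
    proof -
      have "((\<lambda>s. \<phi> y \<xi> (s + t)) has_real_derivative deriv (\<phi> y \<xi>) t) (at 0)"
        using smooth_on_real_deriv(1)[OF sm[OF \<xi>], of y t] DERIV_shift[of "\<phi> y \<xi>" _ 0 t] by simp
      then show ?thesis by (auto intro!: derivative_eq_intros)
    qed
    ultimately show ?thesis using \<FF>(2)[OF \<xi>] DERIV_imp_deriv by metis
  qed
  have deriv2: "(deriv (\<phi> y \<xi>) has_real_derivative (deriv ^^ 2) (\<phi> y \<xi>) t) (at t)" if "\<xi> \<in> \<aa>" for y \<xi> t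
    using smooth_on_real_deriv(1)[OF smooth_on_real_deriv(2)[OF sm[OF that]]]
    by (simp add: numeral_2_eq_2)
  \<comment> \<open>Applying \<open>S\<close> to \<open>\<FF>\<close> gives the Euclidean gradient
    that the locale requires.\<close>
  interpret ga: gradient_action \<aa> "\<lambda>\<xi>. act (ex \<xi>)" "\<lambda>y \<xi>. \<Psi> y (ex \<xi>)" "\<lambda>y. S (\<FF> y)"
  proof
    show "subspace \<aa>" by fact
    show "act (ex (\<xi> + \<eta>)) y = act (ex \<xi>) (act (ex \<eta>) y)" if "\<xi> \<in> \<aa>" "\<eta> \<in> \<aa>" for \<xi> \<eta> y
      using that by (simp add: ex_add act_mult)
    show "act (ex 0) y = y" for y by (simp add: exp_zero act_one)
    show "continuous_on UNIV (act (ex \<xi>))" for \<xi>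
    proof -
      have "continuous_on UNIV (\<lambda>y. (\<lambda>(g, y). act g y) (ex \<xi>, y))"
        by (rule continuous_on_compose2[OF act_cont]) (auto intro: continuous_intros)
      then show ?thesis by simp
    qed
    show "\<Psi> y (ex (\<xi> + \<eta>)) = \<Psi> y (ex \<xi>) + \<Psi> (act (ex \<xi>) y) (ex \<eta>)" if "\<xi> \<in> \<aa>" "\<eta> \<in> \<aa>" for \<xi> \<eta> y
      by (rule cocycle[OF that])
    show "continuous_on \<aa> (\<lambda>\<xi>. \<Psi> y (ex \<xi>))" for y
    proof -
      have "Ck_on 0 UNIV (\<lambda>\<zeta>. \<Psi> y (ex (P \<zeta>)))"
        using KN_smooth[OF P(1,2)] unfolding smooth_on_def by blast
      then have "continuous_on \<aa> (\<lambda>\<zeta>. \<Psi> y (ex (P \<zeta>)))" using continuous_on_subset by auto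
      then show ?thesis by (rule continuous_on_eq) (simp add: P(3))
    qed
    show "S (\<FF> y) \<in> \<aa>" for y using S(3) \<FF>(1) by blast
    show "((\<lambda>t. \<Psi> y (ex (t *\<^sub>R \<xi>))) has_real_derivative S (\<FF> y) \<bullet> \<xi>) (at 0)" if "\<xi> \<in> \<aa>" for \<xi> y
      using smooth_on_real_deriv(1)[OF sm[OF that], of y 0] S(4)[OF \<FF>(1) that] \<FF>(2)[OF that]
      by (simp add: \<phi>_def)
    show "continuous_on UNIV (\<lambda>y. S (\<FF> y))"
      using linear_continuous_on[of S UNIV] S(1) continuous_on_compose2[OF _ \<FF>_cont, of UNIV S]
      by (simp add: linear_conv_bounded_linear)
    show "S (\<FF> y) \<bullet> \<xi> \<le> S (\<FF> (act (ex (t *\<^sub>R \<xi>)) y)) \<bullet> \<xi>" if \<xi>: "\<xi> \<in> \<aa>" and "0 \<le> t" for \<xi> t y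
    proof -
      have "deriv (\<phi> y \<xi>) 0 \<le> deriv (\<phi> y \<xi>) t"
        using DERIV_nonneg_imp_nondecreasing[OF \<open>0 \<le> t\<close>, of "deriv (\<phi> y \<xi>)"]
          deriv2[OF \<xi>] KN_convex[OF \<xi>] unfolding \<phi>_def by blast
      then show ?thesis by (simp add: S(4)[OF \<FF>(1) \<xi>] \<FF>(2)[OF \<xi>] \<FF>_along[OF \<xi>, unfolded \<FF>(2)[OF \<xi>]])
    qed
    show "act (ex (s *\<^sub>R \<xi>)) y = y"
      if \<xi>: "\<xi> \<in> \<aa>" and const: "\<And>t. 0 \<le> t \<Longrightarrow> S (\<FF> (act (ex (t *\<^sub>R \<xi>)) y)) \<bullet> \<xi> = S (\<FF> y) \<bullet> \<xi>" for \<xi> y s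
    proof -
      have eq: "deriv (\<phi> y \<xi>) t = deriv (\<phi> y \<xi>) 0" if "0 \<le> t" for t
        using const[OF that] by (simp add: S(4)[OF \<FF>(1) \<xi>] \<FF>_along[OF \<xi>] \<FF>(2)[OF \<xi>, of y])
      \<comment> \<open>The slope is known to be constant for \<open>0 \<le> t\<close>; a positive
        second derivative at \<open>0\<close> would force strict growth immediately to the
        right.\<close>
      have "\<not> 0 < (deriv ^^ 2) (\<phi> y \<xi>) 0"
      proof
        assume "0 < (deriv ^^ 2) (\<phi> y \<xi>) 0"
        then obtain d where d: "0 < d" "\<forall>h>0. h < d \<longrightarrow> deriv (\<phi> y \<xi>) 0 < deriv (\<phi> y \<xi>) (0 + h)"
          using DERIV_pos_inc_right[OF deriv2[OF \<xi>]] by blast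
        then have "deriv (\<phi> y \<xi>) 0 < deriv (\<phi> y \<xi>) (0 + d / 2)" by simp
        with eq[of "d / 2"] d(1) show False by simp
      qed
      with KN_convex[OF \<xi>, of y 0] have "(deriv ^^ 2) (\<phi> y \<xi>) 0 = 0" by (simp add: \<phi>_def)
      from KN_stab[OF \<xi> this[unfolded \<phi>_def]] show ?thesis by (auto simp: stabilizer_def)
    qed
  qed
  have orb: "ga.orb x = Ax"
    by (auto simp: ga.orb_def Ax_def orbit_def A_def)
  have fixed: "ga.fixed = fixed_points A act"
    by (auto simp: ga.fixed_def fixed_points_def invariants_def A_def)
  let ?F = "closure Ax \<inter> fixed_points A act"
  \<comment> \<open>Being linear, \<open>S\<close> commutes with convex hulls, and it is injective
    on \<open>\<aa>\<close>, which contains both sets; so the Euclidean equality descends to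
    \<open>\<FF>\<close>.\<close>
  have "S ` \<FF> ` closure Ax = convex hull (S ` \<FF> ` ?F)"
    using ga.gradient_closure_orbit[of x] \<open>compact (closure Ax)\<close>
    by (simp add: orb fixed image_image)
  then have "S ` (\<FF> ` closure Ax) = S ` (convex hull (\<FF> ` ?F))"
    by (simp only: convex_hull_linear_image[OF S(1)])
  moreover have "\<FF> ` closure Ax \<subseteq> \<aa>" using \<FF>(1) by auto
  moreover have "convex hull (\<FF> ` ?F) \<subseteq> \<aa>"
    by (rule hull_minimal) (use \<FF>(1) subspace_imp_convex[OF V] in auto)
  ultimately have "\<FF> ` closure Ax = convex hull (\<FF> ` ?F)"
    using inj_on_image_eq_iff[OF S(2)] by blast
  then show ?thesis
    using closure_image_of_compact_closure[OF \<open>compact (closure Ax)\<close> \<FF>_cont] by simp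
qed

end
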